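(* Consider, over $\mathbb F\in\{\mathbb R,\mathbb C,\mathbb H\}$, a system of matrix equations $$A_iX_{i'}^{\varepsilon_i}-X_{i''}^{\delta_i}B_i=C_i,\qquad i=1,\dots,s,\tag{S}$$ with unknown matrices $X_1,\dots,X_t$ over $\mathbb F$ (of prescribed sizes compatible with the given matrices $A_i,B_i,C_i$ over $\mathbb F$), where $i',i''\in\{1,\dots,t\}$ are indices depending on $i$, and consider the conditions $$\begin{bmatrix}A_i&0\\0&B_i\end{bmatrix}P_{i'}^{\langle\varepsilon_i\rangle}=P_{i''}^{\langle\delta_i\rangle}\begin{bmatrix}A_i&C_i\\0&B_i\end{bmatrix},\qquad i=1,\dots,s.\tag{R}$$ (a) Over $\mathbb R$, the system (S) with all $\varepsilon_i,\delta_i\in\{1,\top\}$ has a solution if and only if (R) holds for some nonsingular real matrices $P_1,\dots,P_t$, where $P^{\langle 1\rangle}:=P$ and $P^{\langle\top\rangle}:=J(P^{\top})^{-1}J^{-1}$. (b) Over $\mathbb C$, the system (S) with all $\varepsilon_i,\delta_i\in\{1,\complement,\top,*\}$, where $A^{\complement}:=\bar A$ is the complex conjugate matrix and $A^{*}:=\bar A^{\top}$ is the complex adjoint matrix, has a solution if and only if (R) holds for some nonsingular complex matrices $P_1,\dots,P_t$, where $P^{\langle\sigma\rangle}:=P^{\sigma}$ if $\sigma\in\{1,\complement\}$ and $P^{\langle\sigma\rangle}:=J(P^{\sigma})^{-1}J^{-1}$ if $\sigma\in\{\top,*\}$. (c) Over the skew field of real quaternions $\mathbb H$, for each $h=a+bi+cj+dk\in\mathbb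 H$ ($a,b,c,d\in\mathbb R$) put $$h^{\complement}:=a+bi-cj-dk,\qquad h^{\circ}:=a-bi+cj+dk,\qquad \bar h=(h^{\complement})^{\circ}=a-bi-cj-dk,$$ and for each quaternion matrix $A$ put $A^{\dagger}=(A^{\circ})^{\top}$, $A^{*}=\bar A^{\top}$ (with $\complement$, $\circ$, bar applied entrywise). Then the system (S) with all $\varepsilon_i,\delta_i\in\{1,\complement,\dagger,*\}$ has a solution if and only if (R) holds for some nonsingular quaternion matrices $P_1,\dots,P_t$, where $P^{\langle\sigma\rangle}:=P^{\sigma}$ if $\sigma\in\{1,\complement\}$ and $P^{\langle\sigma\rangle}:=J(P^{\sigma})^{-1}J^{-1}$ if $\sigma\in\{\dagger,*\}$. Here $J:=\begin{bmatrix}0&I\\-I&0\end{bmatrix}$ throughout.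
   Context: For a matrix $A$, $A^{1}:=A$ and $A^{\top}$ is the transpose. Sizes: each unknown $X_j$ has a prescribed size $m_j\times n_j$ (so $X_j^{\sigma}$ is $m_j\times n_j$ for $\sigma\in\{1,\complement\}$ and $n_j\times m_j$ for $\sigma\in\{\top,\dagger,*\}$), and the sizes of $A_i,B_i,C_i$ are such that the equations make sense. The matrix $P_j$ is square of size $(m_j+n_j)\times(m_j+n_j)$, partitioned conformally with $\begin{bmatrix}I_{m_j}&X_j\\0&I_{n_j}\end{bmatrix}$. In the definition of $P_j^{\langle\sigma\rangle}$ with $\sigma\in\{\top,\dagger,*\}$, $J=\begin{bmatrix}0&I_{n_j}\\-I_{m_j}&0\end{bmatrix}$. *)

theory Defs
  imports Complex_Main "Jordan_Normal_Form.Matrix"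
begin

section \<open>The skew field of real quaternions\<close>

datatype quat = Quat (q_re: real) (q_i: real) (q_j: real) (q_k: real)

instantiation quat :: division_ring
begin

definition zero_quat :: quat where
  "0 = Quat 0 0 0 0"

definition one_quat :: quat where
  "1 = Quat 1 0 0 0"

definition plus_quat :: "quat \<Rightarrow> quat \<Rightarrow> quat" where
  "x + y = Quat (q_re x + q_re y) (q_i x + q_i y) (q_j x + q_j y) (q_k x + q_k y)"

definition uminus_quat :: "quat \<Rightarrow> quat" where
  "- x = Quat (- q_re x) (- q_i x) (- q_j x) (- q_k x)"

definition minus_quat :: "quat \<Rightarrow> quat \<Rightarrow> quat" where
  "x - y = Quat (q_re x - q_re y) (q_i x - q_i y) (q_j x - q_j y) (q_k x - q_k y)"

definition times_quat :: "quat \<Rightarrow> quat \<Rightarrow> quat" where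
  "x * y = Quat
     (q_re x * q_re y - q_i x * q_i y - q_j x * q_j y - q_k x * q_k y)
     (q_re x * q_i y + q_i x * q_re y + q_j x * q_k y - q_k x * q_j y)
     (q_re x * q_j y - q_i x * q_k y + q_j x * q_re y + q_k x * q_i y)
     (q_re x * q_k y + q_i x * q_j y - q_j x * q_i y + q_k x * q_re y)"

definition inverse_quat :: "quat \<Rightarrow> quat" where
  "inverse x =
     (let N = (q_re x)\<^sup>2 + (q_i x)\<^sup>2 + (q_j x)\<^sup>2 + (q_k x)\<^sup>2
      in Quat (q_re x / N) (- q_i x / N) (- q_j x / N) (- q_k x / N))"

definition divide_quat :: "quat \<Rightarrow> quat \<Rightarrow> quat" where
  "x div y = x * inverse (y :: quat)"

instance
proof
  have N: "a\<^sup>2 + b\<^sup>2 + c\<^sup>2 + d\<^sup>2 \<noteq> 0" if "Quat a b c d \<noteq> 0" for a b c d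
    using that unfolding zero_quat_def
    by (auto simp: add_nonneg_eq_0_iff)
  fix x :: quat
  assume x: "x \<noteq> 0"
  obtain a b c d where xq: "x = Quat a b c d" by (cases x)
  let ?N = "a\<^sup>2 + b\<^sup>2 + c\<^sup>2 + d\<^sup>2"
  have nz: "?N \<noteq> 0" using N x xq by blast
  have one: "a * (a / ?N) + b * (b / ?N) + c * (c / ?N) + d * (d / ?N) = 1"
    using nz by (simp add: power2_eq_square flip: add_divide_distrib)
  show "inverse x * x = 1"
    using one
    by (simp add: xq inverse_quat_def times_quat_def one_quat_def Let_def algebra_simps)
  show "x * inverse x = 1"
    using one
    by (simp add: xq inverse_quat_def times_quat_def one_quat_def Let_def algebra_simps)
qed (auto simp: zero_quat_def one_quat_def plus_quat_def uminus_quat_def minus_quat_def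
      times_quat_def inverse_quat_def divide_quat_def Let_def quat.expand algebra_simps)

end

lemma quat_units:
  defines "i \<equiv> Quat 0 1 0 0" and "j \<equiv> Quat 0 0 1 0" and "k \<equiv> Quat 0 0 0 1"
  shows "i * i = - 1" "j * j = - 1" "k * k = - 1" "i * j = k" "j * k = i" "k * i = j"
    "j * i = - k" "k * j = - i" "i * k = - j"
  by (simp_all add: i_def j_def k_def times_quat_def one_quat_def uminus_quat_def)

definition quat_compl :: "quat \<Rightarrow> quat" where
  "quat_compl h = Quat (q_re h) (q_i h) (- q_j h) (- q_k h)"

definition quat_circ :: "quat \<Rightarrow> quat" where
  "quat_circ h = Quat (q_re h) (- q_i h) (q_j h) (q_k h)"

definition quat_cnj :: "quat \<Rightarrow> quat" where
  "quat_cnj h = Quat (q_re h) (- q_i h) (- q_j h) (- q_k h)"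

lemma quat_cnj_eq: "quat_cnj h = quat_circ (quat_compl h)"
  by (simp add: quat_cnj_def quat_circ_def quat_compl_def)

section \<open>Matrix operations indexed by exponents\<close>

datatype exponent = Ident | Compl | Transp | Dagger | Star

primrec (nonexhaustive) real_op :: "exponent \<Rightarrow> real mat \<Rightarrow> real mat" where
  "real_op Ident A = A"
| "real_op Transp A = transpose_mat A"

primrec (nonexhaustive) complex_op :: "exponent \<Rightarrow> complex mat \<Rightarrow> complex mat" where
  "complex_op Ident A = A"
| "complex_op Compl A = map_mat cnj A"
| "complex_op Transp A = transpose_mat A"
| "complex_op Star A = transpose_mat (map_mat cnj A)"

primrec (nonexhaustive) quat_op :: "exponent \<Rightarrow> quat mat \<Rightarrow> quat mat" where
  "quat_op Ident A = A"
| "quat_op Compl A = map_mat quat_compl A"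
| "quat_op Dagger A = transpose_mat (map_mat quat_circ A)"
| "quat_op Star A = transpose_mat (map_mat quat_cnj A)"

text \<open>The size of \<open>X\<^sup>\<sigma>\<close> for \<open>X\<close> of size \<open>m \<times> n\<close>.\<close>

definition op_rows :: "exponent \<Rightarrow> nat \<Rightarrow> nat \<Rightarrow> nat" where
  "op_rows \<sigma> m n = (if \<sigma> \<in> {Ident, Compl} then m else n)"

definition op_cols :: "exponent \<Rightarrow> nat \<Rightarrow> nat \<Rightarrow> nat" where
  "op_cols \<sigma> m n = (if \<sigma> \<in> {Ident, Compl} then n else m)"

section \<open>The solvability criterion\<close>

text \<open>The two-sided inverse of a matrix; it is unique if it exists, and the value is
  unspecified for singular matrices.\<close>

definition inv_mat :: "'a :: semiring_1 mat \<Rightarrow> 'a mat" where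
  "inv_mat A = (THE B. inverts_mat A B \<and> inverts_mat B A)"

definition J_mat :: "nat \<Rightarrow> nat \<Rightarrow> 'a :: ring_1 mat" where
  "J_mat m n = four_block_mat (0\<^sub>m n m) (1\<^sub>m n) (- 1\<^sub>m m) (0\<^sub>m m n)"

text \<open>In the following definitions \<open>pw\<close> is one of \<^const>\<open>real_op\<close>, \<^const>\<open>complex_op\<close>,
  \<^const>\<open>quat_op\<close>. The matrix \<open>P\<^sup>\<langle>\<^sup>\<sigma>\<^sup>\<rangle>\<close> depends on the size \<open>m \<times> n\<close> of the unknown
  to which \<open>P\<close> belongs, through \<open>J\<close>.\<close>

definition angle_op ::
  "(exponent \<Rightarrow> 'a mat \<Rightarrow> 'a mat) \<Rightarrow> nat \<Rightarrow> nat \<Rightarrow> exponent \<Rightarrow> 'a :: ring_1 mat \<Rightarrow> 'a mat" where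
  "angle_op pw m n \<sigma> P =
     (if \<sigma> \<in> {Ident, Compl} then pw \<sigma> P
      else J_mat m n * inv_mat (pw \<sigma> P) * inv_mat (J_mat m n))"

text \<open>A system consists of \<open>s\<close> equations in unknowns \<open>X\<^sub>0, \<dots>, X\<^bsub>t-1\<^esub>\<close>, where \<open>X\<^sub>j\<close> has size
  \<open>m j \<times> n j\<close>; the \<open>i\<close>-th equation is
  \<open>A\<^sub>i X\<^bsub>u i\<^esub>\<^bsup>\<epsilon> i\<^esup> - X\<^bsub>v i\<^esub>\<^bsup>\<delta> i\<^esup> B\<^sub>i = C\<^sub>i\<close>. The sizes below are the only ones for which
  all products and differences make sense.\<close>

definition compatible_sizes ::
  "nat \<Rightarrow> (nat \<Rightarrow> nat) \<Rightarrow> (nat \<Rightarrow> nat) \<Rightarrow> (nat \<Rightarrow> nat) \<Rightarrow> (nat \<Rightarrow> nat) \<Rightarrow>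
   (nat \<Rightarrow> exponent) \<Rightarrow> (nat \<Rightarrow> exponent) \<Rightarrow>
   (nat \<Rightarrow> 'a mat) \<Rightarrow> (nat \<Rightarrow> 'a mat) \<Rightarrow> (nat \<Rightarrow> 'a mat) \<Rightarrow> bool" where
  "compatible_sizes s m n u v \<epsilon> \<delta> A B C \<longleftrightarrow>
     (\<forall>i<s. let rX = op_rows (\<epsilon> i) (m (u i)) (n (u i)); cX = op_cols (\<epsilon> i) (m (u i)) (n (u i));
                rY = op_rows (\<delta> i) (m (v i)) (n (v i)); cY = op_cols (\<delta> i) (m (v i)) (n (v i))
            in A i \<in> carrier_mat rY rX \<and> B i \<in> carrier_mat cY cX \<and> C i \<in> carrier_mat rY cX)"

definition has_solution ::
  "(exponent \<Rightarrow> 'a mat \<Rightarrow> 'a mat) \<Rightarrow> nat \<Rightarrow> nat \<Rightarrow> (nat \<Rightarrow> nat) \<Rightarrow> (nat \<Rightarrow> nat) \<Rightarrow>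
   (nat \<Rightarrow> nat) \<Rightarrow> (nat \<Rightarrow> nat) \<Rightarrow> (nat \<Rightarrow> exponent) \<Rightarrow> (nat \<Rightarrow> exponent) \<Rightarrow>
   (nat \<Rightarrow> 'a mat) \<Rightarrow> (nat \<Rightarrow> 'a mat) \<Rightarrow> (nat \<Rightarrow> 'a :: ring_1 mat) \<Rightarrow> bool" where
  "has_solution pw s t m n u v \<epsilon> \<delta> A B C \<longleftrightarrow>
     (\<exists>X. (\<forall>j<t. X j \<in> carrier_mat (m j) (n j)) \<and>
          (\<forall>i<s. A i * pw (\<epsilon> i) (X (u i)) - pw (\<delta> i) (X (v i)) * B i = C i))"

definition block_condition ::
  "(exponent \<Rightarrow> 'a mat \<Rightarrow> 'a mat) \<Rightarrow> nat \<Rightarrow> (nat \<Rightarrow> nat) \<Rightarrow> (nat \<Rightarrow> nat) \<Rightarrow>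
   (nat \<Rightarrow> nat) \<Rightarrow> (nat \<Rightarrow> nat) \<Rightarrow> (nat \<Rightarrow> exponent) \<Rightarrow> (nat \<Rightarrow> exponent) \<Rightarrow>
   (nat \<Rightarrow> 'a mat) \<Rightarrow> (nat \<Rightarrow> 'a mat) \<Rightarrow> (nat \<Rightarrow> 'a mat) \<Rightarrow> (nat \<Rightarrow> 'a :: ring_1 mat) \<Rightarrow> bool" where
  "block_condition pw s m n u v \<epsilon> \<delta> A B C P \<longleftrightarrow>
     (\<forall>i<s.
        four_block_mat (A i) (0\<^sub>m (dim_row (A i)) (dim_col (B i)))
                       (0\<^sub>m (dim_row (B i)) (dim_col (A i))) (B i)
          * angle_op pw (m (u i)) (n (u i)) (\<epsilon> i) (P (u i)) =
        angle_op pw (m (v i)) (n (v i)) (\<delta> i) (P (v i))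
          * four_block_mat (A i) (C i)
                           (0\<^sub>m (dim_row (B i)) (dim_col (A i))) (B i))"

end

theory Submission
  imports Defs "HOL-Library.Function_Algebras"
begin

text \<open>
  Without transpositions this is Roth's removal rule, proved by a dimension count. Put
  \<open>D\<^sub>i = diag(A\<^sub>i, B\<^sub>i)\<close> and let \<open>M\<^sub>i\<close> be the block triangular matrix on the right of (R).
  Right multiplication by the \<open>P\<^sub>j\<close> embeds the space of families \<open>Z\<close> with \<open>D\<^sub>i Z = Z D\<^sub>i\<close> into the
  space of those with \<open>D\<^sub>i Z = Z M\<^sub>i\<close>. First block columns of members of the second space also
  occur in the first one, and members with vanishing first block column satisfy the same equations in
  both. By finite dimension the first block columns are the same, so that \<open>(I, 0)\<close> occurs in the second
  space, and the upper right blocks of such a \<open>Z\<close> solve the system. All spaces are real, so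
  the conjugations are harmless.

  Transpositions are removed by treating \<open>X\<^sub>j\<close> and its adjoint as independent unknowns and adding the
  adjoint equations to the system; \<open>P \<mapsto> J (P\<^sup>\<dagger>)\<^sup>-\<^sup>1 J\<^sup>-\<^sup>1\<close> is an involution carrying (R) into its
  analogue for the adjoint equations. Averaging a solution with its adjoint restores the dependence.
\<close>

section \<open>Real vector spaces\<close>

text \<open>The image of a basis of \<open>S\<close> is again independent and has as many elements.
  A vector of \<open>S\<close> outside its span would extend it to an independent set larger than
  the basis.\<close>

lemma linear_inj_on_image_eq:
  fixes T :: "'w::real_vector \<Rightarrow> 'w"
  assumes T: "linear T" "inj_on T S" "T ` S \<subseteq> S"
    and S: "subspace S" "S \<subseteq> span F" and F: "finite F"
  shows "T ` S = S"
proof -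
  obtain B where B: "B \<subseteq> S" "independent B" "S \<subseteq> span B"
    using real_vector.maximal_independent_subset by blast
  have spB: "span B = S"
    using B S(1) by (metis span_minimal subset_antisym)
  have finB: "finite B"
    using real_vector.independent_span_bound[OF F B(2)] B(1) S(2) by blast
  have ind: "independent (T ` B)"
    using linear_independent_injective_image[OF T(1) B(2)] T(2) spB by simp
  have card: "card (T ` B) = card B"
    using T(2) B(1) by (meson card_image inj_on_subset)
  have "S \<subseteq> span (T ` B)"
  proof (rule ccontr)
    assume "\<not> S \<subseteq> span (T ` B)"
    then obtain e where e: "e \<in> S" "e \<notin> span (T ` B)" by blast
    have "independent (insert e (T ` B))"
      by (rule real_vector.independent_insertI[OF e(2) ind])
    moreover have "insert e (T ` B) \<subseteq> span B"
      using e(1) T(3) B(1) spB by blast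
    ultimately have "card (insert e (T ` B)) \<le> card B"
      using real_vector.independent_span_bound[OF finB] by blast
    moreover have "card (insert e (T ` B)) = Suc (card B)"
      using e(2) finB card by (metis card_insert_disjoint finite_imageI span_base)
    ultimately show False by simp
  qed
  also have "span (T ` B) = T ` S"
    using linear_span_image[OF T(1)] spB by simp
  finally show ?thesis using T(3) by blast
qed

text \<open>Splitting \<open>V = (V \<inter> ker \<pi>) \<oplus> \<sigma> (\<pi> V)\<close> along a section \<open>\<sigma>\<close> of the projection \<open>\<pi>\<close> embeds \<open>V\<close>
  into \<open>V\<^sub>0\<close>; composed with the injection \<open>\<phi>\<close> of \<open>V\<^sub>0\<close> into \<open>V\<close>, this is an injective endomorphism of
  the finite-dimensional space \<open>V\<^sub>0\<close>, hence surjective.\<close>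

lemma projection_image_subset:
  fixes \<phi> \<pi> :: "'w::real_vector \<Rightarrow> 'w"
  assumes V0: "subspace V0" "V0 \<subseteq> span F" and F: "finite F" and V: "subspace V"
    and \<phi>: "linear \<phi>" "inj_on \<phi> V0" "\<phi> ` V0 \<subseteq> V"
    and \<pi>: "linear \<pi>" "\<And>w. \<pi> (\<pi> w) = \<pi> w" "\<pi> ` V \<subseteq> V0"
    and ker: "\<And>w. w \<in> V \<Longrightarrow> \<pi> w = 0 \<Longrightarrow> w \<in> V0"
  shows "\<pi> ` V0 \<subseteq> \<pi> ` V"
proof -
  \<comment> \<open>All values of \<open>\<sigma>\<close> lie in \<open>V\<close>, so it chooses
    preimages under \<open>\<pi>\<close> linearly without leaving \<open>V\<close>.\<close>
  obtain \<sigma> where \<sigma>: "range \<sigma> \<subseteq> V" "linear \<sigma>" "\<And>w. w \<in> \<pi> ` V \<Longrightarrow> \<pi> (\<sigma> w) = w"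
    using linear_exists_right_inverse_on[OF \<pi>(1) V] by blast
  \<comment> \<open>For \<open>w\<close> in \<open>V\<close> the first summand lies in
    \<open>V0\<close> because \<open>\<pi>\<close> maps \<open>V\<close> into \<open>V0\<close>, the
    second because it is a member of \<open>V\<close> killed by \<open>\<pi>\<close>. Applying
    \<open>\<pi>\<close> recovers the first summand, which makes \<open>\<theta>\<close> injective
    on \<open>V\<close>.\<close>
  define \<theta> where "\<theta> w = \<pi> w + (w - \<sigma> (\<pi> w))" for w
  have lin\<theta>: "linear \<theta>"
    unfolding \<theta>_def
    by (intro linear_compose_add linear_compose_sub \<pi>(1) linear_ident
        linear_compose[OF \<pi>(1) \<sigma>(2), unfolded o_def])
  have diff: "w - \<sigma> (\<pi> w) \<in> V" "\<pi> (w - \<sigma> (\<pi> w)) = 0" if "w \<in> V" for w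
    using that \<sigma> V by (auto intro!: subspace_diff simp: linear_diff[OF \<pi>(1)])
  have \<theta>V: "\<theta> w \<in> V0" if "w \<in> V" for w
    unfolding \<theta>_def using that \<pi>(3) ker diff by (auto intro!: subspace_add[OF V0(1)])
  have \<pi>\<theta>: "\<pi> (\<theta> w) = \<pi> w" if "w \<in> V" for w
    unfolding \<theta>_def using diff(2)[OF that] \<pi>(2) by (simp add: linear_add[OF \<pi>(1)])
  have \<theta>0: "w = 0" if "w \<in> V" "\<theta> w = 0" for w
  proof -
    have "\<pi> w = 0"
      using \<pi>\<theta>[OF that(1)] that(2) linear_0[OF \<pi>(1)] by simp
    then show ?thesis
      using that(2) linear_0[OF \<sigma>(2)] by (simp add: \<theta>_def)
  qed
  have "inj_on (\<theta> \<circ> \<phi>) V0"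
  proof (rule linear_inj_on_iff_eq_0[OF linear_compose[OF \<phi>(1) lin\<theta>] V0(1), THEN iffD2], intro ballI impI)
    fix w assume w: "w \<in> V0" "(\<theta> \<circ> \<phi>) w = 0"
    then have "\<phi> w = 0" using \<theta>0 \<phi>(3) by auto
    then show "w = 0"
      using linear_inj_on_iff_eq_0[OF \<phi>(1) V0(1)] \<phi>(2) w(1) by blast
  qed
  moreover have "(\<theta> \<circ> \<phi>) ` V0 \<subseteq> V0" using \<theta>V \<phi>(3) by auto
  ultimately have "(\<theta> \<circ> \<phi>) ` V0 = V0"
    using linear_inj_on_image_eq[OF linear_compose[OF \<phi>(1) lin\<theta>] _ _ V0 F] by blast
  then have "\<pi> ` V0 = (\<lambda>w. \<pi> (\<theta> (\<phi> w))) ` V0"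
    by (metis comp_apply image_cong image_image)
  also have "\<dots> = \<pi> ` \<phi> ` V0"
    unfolding image_image using \<pi>\<theta> \<phi>(3) by (intro image_cong) auto
  finally show ?thesis using \<phi>(3) by blast
qed

section \<open>Finitely supported functions inside a finite-dimensional real space\<close>

instantiation "fun" :: (type, real_vector) real_vector
begin

definition scaleR_fun :: "real \<Rightarrow> ('a \<Rightarrow> 'b) \<Rightarrow> 'a \<Rightarrow> 'b" where
  "scaleR_fun r f = (\<lambda>x. r *\<^sub>R f x)"

instance
  by standard (auto simp: scaleR_fun_def fun_eq_iff scaleR_add_right scaleR_add_left)

end

text \<open>A function supported in \<open>S\<close> is the sum of functions concentrated at one
  index of \<open>S\<close>. Placing a vector at an index is linear, so the copies of
  \<open>E\<close> at the indices in \<open>S\<close> span.\<close>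

lemma finite_support_span:
  fixes E :: "'a::real_vector set"
  assumes E: "finite E" "span E = UNIV" and S: "finite S"
  shows "\<exists>F. finite F \<and> {w :: 'i \<Rightarrow> 'a. \<forall>i. i \<notin> S \<longrightarrow> w i = 0} \<subseteq> span F"
proof -
  define single where "single i x = (\<lambda>j. if j = i then x else 0)" for i :: 'i and x :: 'a
  define F where "F = (\<Union>i\<in>S. single i ` E)"
  have lin: "linear (single i)" for i
    by (rule linearI) (auto simp: single_def fun_eq_iff scaleR_fun_def)
  have "w \<in> span F" if w: "\<And>i. i \<notin> S \<Longrightarrow> w i = 0" for w
  proof -
    have "single i (w i) \<in> span F" if "i \<in> S" for i
    proof -
      have "single i (w i) \<in> single i ` span E" using E(2) by simp
      also have "\<dots> = span (single i ` E)" using linear_span_image[OF lin] by simp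
      also have "\<dots> \<subseteq> span F" by (rule span_mono) (use that in \<open>auto simp: F_def\<close>)
      finally show ?thesis .
    qed
    then have "(\<Sum>i\<in>S. single i (w i)) \<in> span F" by (rule span_sum)
    also have "(\<Sum>i\<in>S. single i (w i)) = w"
    proof
      fix j
      have "(\<Sum>i\<in>S. single i (w i)) j = (\<Sum>i\<in>S. single i (w i) j)"
        using S by (induction S rule: finite_induct) (auto simp: zero_fun_def)
      also have "\<dots> = w j"
        using S w by (simp add: single_def sum.delta)
      finally show "(\<Sum>i\<in>S. single i (w i)) j = w j" .
    qed
    finally show ?thesis .
  qed
  moreover have "finite F" using E S by (simp add: F_def)
  ultimately show ?thesis by blast
qed

section \<open>Systems without transposition\<close>

text \<open>Real scalars commute with all entries, so they can be pulled out of either factor even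
  when the entries do not commute.\<close>

lemma map_scaleR_mult_mat:
  fixes A B :: "'a::real_algebra_1 mat"
  assumes "A \<in> carrier_mat n k" "B \<in> carrier_mat k l"
  shows "map_mat ((*\<^sub>R) r) (A * B) = map_mat ((*\<^sub>R) r) A * B"
    and "map_mat ((*\<^sub>R) r) (A * B) = A * map_mat ((*\<^sub>R) r) B"
  using assms by (auto intro!: eq_matI simp: scalar_prod_def scaleR_sum_right)

text \<open>A family of square matrices \<open>Z\<^sub>k\<close> of sizes \<open>N k\<close> is stored as the function
  \<open>(k, r, c) \<mapsto> Z\<^sub>k $$ (r, c)\<close>, so that families form a real vector space.\<close>

definition fam_mat :: "('k \<Rightarrow> nat) \<Rightarrow> ('k \<times> nat \<times> nat \<Rightarrow> 'a) \<Rightarrow> 'k \<Rightarrow> 'a mat" where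
  "fam_mat N w k = mat (N k) (N k) (\<lambda>(r, c). w (k, r, c))"

definition fam_supp :: "'k set \<Rightarrow> ('k \<Rightarrow> nat) \<Rightarrow> ('k \<times> nat \<times> nat) set" where
  "fam_supp K N = (SIGMA k:K. {..<N k} \<times> {..<N k})"

text \<open>Padding with zeros outside the support makes the function determined by its matrices, as
  \<open>fam_eqI\<close> requires.\<close>

definition fam_of :: "'k set \<Rightarrow> ('k \<Rightarrow> nat) \<Rightarrow> ('k \<Rightarrow> 'a::zero mat) \<Rightarrow> 'k \<times> nat \<times> nat \<Rightarrow> 'a" where
  "fam_of K N Z = (\<lambda>(k, r, c). if (k, r, c) \<in> fam_supp K N then Z k $$ (r, c) else 0)"

lemma fam_mat_carrier [simp]: "fam_mat N w k \<in> carrier_mat (N k) (N k)"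
  by (simp add: fam_mat_def)

lemma fam_mat_add: "fam_mat N (w + w') k = fam_mat N w k + fam_mat N w' k"
  by (auto simp: fam_mat_def)

lemma fam_mat_scaleR: "fam_mat N (r *\<^sub>R w) k = map_mat ((*\<^sub>R) r) (fam_mat N w k)"
  by (auto simp: fam_mat_def scaleR_fun_def)

lemma fam_mat_of:
  "k \<in> K \<Longrightarrow> Z k \<in> carrier_mat (N k) (N k) \<Longrightarrow> fam_mat N (fam_of K N Z) k = Z k"
  by (auto simp: fam_mat_def fam_of_def fam_supp_def)

lemma fam_of_outside: "i \<notin> fam_supp K N \<Longrightarrow> fam_of K N Z i = 0"
  by (cases i) (simp add: fam_of_def)

lemma fam_eqI:
  assumes "\<And>i. i \<notin> fam_supp K N \<Longrightarrow> w i = 0" "\<And>i. i \<notin> fam_supp K N \<Longrightarrow> w' i = 0"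
    and "\<And>k. k \<in> K \<Longrightarrow> fam_mat N w k = fam_mat N w' k"
  shows "w = w'"
proof
  fix i :: "'a \<times> nat \<times> nat"
  obtain k r c where i: "i = (k, r, c)" by (cases i)
  show "w i = w' i"
  proof (cases "i \<in> fam_supp K N")
    case True
    then have "w i = fam_mat N w k $$ (r, c)" "w' i = fam_mat N w' k $$ (r, c)"
      by (auto simp: i fam_supp_def fam_mat_def)
    then show ?thesis using True assms(3) by (simp add: i fam_supp_def)
  qed (use assms in auto)
qed

text \<open>Two instances matter: multiplication by the given \<open>P\<close> is the embedding, and
  multiplication by idempotents is the projection to the first block column.\<close>

definition fam_rmul ::
  "'k set \<Rightarrow> ('k \<Rightarrow> nat) \<Rightarrow> ('k \<Rightarrow> 'a::semiring_0 mat) \<Rightarrow> ('k \<times> nat \<times> nat \<Rightarrow> 'a) \<Rightarrow> 'k \<times> nat \<times> nat \<Rightarrow> 'a" where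
  "fam_rmul K N Q w = fam_of K N (\<lambda>k. fam_mat N w k * Q k)"

lemma fam_mat_rmul:
  assumes "k \<in> K" "Q k \<in> carrier_mat (N k) (N k)"
  shows "fam_mat N (fam_rmul K N Q w) k = fam_mat N w k * Q k"
  unfolding fam_rmul_def
  by (rule fam_mat_of[OF assms(1)], rule mult_carrier_mat, rule fam_mat_carrier, rule assms(2))

lemma linear_fam_rmul:
  fixes Q :: "'k \<Rightarrow> 'a::real_algebra_1 mat"
  assumes Q: "\<And>k. k \<in> K \<Longrightarrow> Q k \<in> carrier_mat (N k) (N k)"
  shows "linear (fam_rmul K N Q)"
proof (rule linearI)
  fix w w' :: "'k \<times> nat \<times> nat \<Rightarrow> 'a" and r :: real
  have outside: "fam_rmul K N Q w i = 0" if "i \<notin> fam_supp K N" for w i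
    unfolding fam_rmul_def by (rule fam_of_outside[OF that])
  show "fam_rmul K N Q (w + w') = fam_rmul K N Q w + fam_rmul K N Q w'"
  proof (rule fam_eqI[of K N])
    fix k assume k: "k \<in> K"
    show "fam_mat N (fam_rmul K N Q (w + w')) k = fam_mat N (fam_rmul K N Q w + fam_rmul K N Q w') k"
      unfolding fam_mat_add fam_mat_rmul[where N = N and Q = Q, OF k Q[OF k]]
      by (rule add_mult_distrib_mat, rule fam_mat_carrier, rule fam_mat_carrier, rule Q[OF k])
  qed (auto simp: outside)
  show "fam_rmul K N Q (r *\<^sub>R w) = r *\<^sub>R fam_rmul K N Q w"
  proof (rule fam_eqI[of K N])
    fix k assume k: "k \<in> K"
    show "fam_mat N (fam_rmul K N Q (r *\<^sub>R w)) k = fam_mat N (r *\<^sub>R fam_rmul K N Q w) k"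
      unfolding fam_mat_scaleR fam_mat_rmul[where N = N and Q = Q, OF k Q[OF k]]
      by (rule map_scaleR_mult_mat(1)[symmetric], rule fam_mat_carrier, rule Q[OF k])
  qed (auto simp: outside scaleR_fun_def)
qed

section \<open>Real algebra endomorphisms acting entrywise\<close>

text \<open>Abstracts the identity and the multiplicative conjugations. Linearity is over the reals
  only, since complex conjugation is not complex linear; multiplicativity lets the map pass through
  matrix products.\<close>

definition real_hom :: "('a::real_algebra_1 \<Rightarrow> 'a) \<Rightarrow> bool" where
  "real_hom f \<longleftrightarrow> linear f \<and> f 1 = 1 \<and> (\<forall>x y. f (x * y) = f x * f y)"

lemma real_hom_mult_mat:
  assumes "real_hom f" "A \<in> carrier_mat n k" "B \<in> carrier_mat k l"
  shows "map_mat f (A * B) = map_mat f A * map_mat f B"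
  using assms by (auto intro!: eq_matI simp: scalar_prod_def real_hom_def linear_sum)

lemma real_hom_add_mat:
  assumes "real_hom f" "A \<in> carrier_mat n k" "B \<in> carrier_mat n k"
  shows "map_mat f (A + B) = map_mat f A + map_mat f B"
  using assms by (auto simp: real_hom_def linear_add)

lemma real_hom_scaleR_mat:
  assumes "real_hom f"
  shows "map_mat f (map_mat ((*\<^sub>R) r) A) = map_mat ((*\<^sub>R) r) (map_mat f A)"
  using assms by (auto simp: real_hom_def linear_scale)

lemma real_hom_0: "real_hom f \<Longrightarrow> f 0 = 0"
  by (simp add: real_hom_def linear_0)

lemma real_hom_1: "real_hom f \<Longrightarrow> f 1 = 1"
  by (simp add: real_hom_def)

lemma real_hom_zero_mat: "real_hom f \<Longrightarrow> map_mat f (0\<^sub>m n k) = 0\<^sub>m n k"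
  by (auto simp: real_hom_0)

section \<open>Spaces of intertwining families\<close>

text \<open>Two such spaces with the same \<open>D\<close> are compared: one has
  \<open>M = D\<close>, the other has the block triangular \<open>M\<close>.\<close>

definition intertwiners ::
  "'k set \<Rightarrow> ('k \<Rightarrow> nat) \<Rightarrow> 'e set \<Rightarrow> ('e \<Rightarrow> 'k) \<Rightarrow> ('e \<Rightarrow> 'k) \<Rightarrow> ('e \<Rightarrow> 'a \<Rightarrow> 'a) \<Rightarrow> ('e \<Rightarrow> 'a \<Rightarrow> 'a) \<Rightarrow>
   ('e \<Rightarrow> 'a mat) \<Rightarrow> ('e \<Rightarrow> 'a mat) \<Rightarrow> ('k \<times> nat \<times> nat \<Rightarrow> 'a::real_algebra_1) set" where
  "intertwiners K N I u v f g D M =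
     {w. (\<forall>i. i \<notin> fam_supp K N \<longrightarrow> w i = 0) \<and>
         (\<forall>i\<in>I. D i * map_mat (f i) (fam_mat N w (u i)) = map_mat (g i) (fam_mat N w (v i)) * M i)}"

lemma subspace_intertwiners:
  fixes D M :: "'e \<Rightarrow> 'a::real_algebra_1 mat" and u :: "'e \<Rightarrow> 'k"
  assumes hom: "\<And>i. i \<in> I \<Longrightarrow> real_hom (f i)" "\<And>i. i \<in> I \<Longrightarrow> real_hom (g i)"
    and D: "\<And>i. i \<in> I \<Longrightarrow> D i \<in> carrier_mat (N (v i)) (N (u i))"
    and M: "\<And>i. i \<in> I \<Longrightarrow> M i \<in> carrier_mat (N (v i)) (N (u i))"
  shows "subspace (intertwiners K N I u v f g D M)" (is "subspace ?V")
proof (rule subspaceI)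
  have Z: "map_mat h (fam_mat N w k) \<in> carrier_mat (N k) (N k)" for h :: "'a \<Rightarrow> 'a" and w k
    by simp
  have "fam_mat N (0 :: 'k \<times> nat \<times> nat \<Rightarrow> 'a) k = 0\<^sub>m (N k) (N k)" for k
    by (auto simp: fam_mat_def)
  then show "0 \<in> ?V"
    by (simp add: intertwiners_def real_hom_zero_mat[OF hom(1)] real_hom_zero_mat[OF hom(2)]
        right_mult_zero_mat[OF D] left_mult_zero_mat[OF M])
  fix x y and r :: real
  assume x: "x \<in> ?V"
  show "r *\<^sub>R x \<in> ?V"
    unfolding intertwiners_def
  proof (intro CollectI conjI ballI)
    show "\<forall>i. i \<notin> fam_supp K N \<longrightarrow> (r *\<^sub>R x) i = 0"
      using x by (auto simp: intertwiners_def scaleR_fun_def)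
    fix i assume i: "i \<in> I"
    have "D i * map_mat (f i) (fam_mat N (r *\<^sub>R x) (u i))
        = map_mat ((*\<^sub>R) r) (D i * map_mat (f i) (fam_mat N x (u i)))"
      unfolding fam_mat_scaleR real_hom_scaleR_mat[OF hom(1)[OF i]]
      by (rule map_scaleR_mult_mat(2)[OF D[OF i] Z, symmetric])
    also have "\<dots> = map_mat ((*\<^sub>R) r) (map_mat (g i) (fam_mat N x (v i)) * M i)"
      using x i by (simp add: intertwiners_def)
    also have "\<dots> = map_mat (g i) (fam_mat N (r *\<^sub>R x) (v i)) * M i"
      unfolding fam_mat_scaleR real_hom_scaleR_mat[OF hom(2)[OF i]]
      by (rule map_scaleR_mult_mat(1)[OF Z M[OF i]])
    finally show "D i * map_mat (f i) (fam_mat N (r *\<^sub>R x) (u i))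
      = map_mat (g i) (fam_mat N (r *\<^sub>R x) (v i)) * M i" .
  qed
  assume y: "y \<in> ?V"
  show "x + y \<in> ?V"
    unfolding intertwiners_def
  proof (intro CollectI conjI ballI)
    show "\<forall>i. i \<notin> fam_supp K N \<longrightarrow> (x + y) i = 0"
      using x y by (auto simp: intertwiners_def)
    fix i assume i: "i \<in> I"
    have "D i * map_mat (f i) (fam_mat N (x + y) (u i))
        = D i * map_mat (f i) (fam_mat N x (u i)) + D i * map_mat (f i) (fam_mat N y (u i))"
      unfolding fam_mat_add real_hom_add_mat[OF hom(1)[OF i] fam_mat_carrier[of N] fam_mat_carrier[of N]]
      by (rule mult_add_distrib_mat[OF D[OF i] Z Z])
    also have "\<dots> = map_mat (g i) (fam_mat N x (v i)) * M i + map_mat (g i) (fam_mat N y (v i)) * M i"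
      using x y i by (simp add: intertwiners_def)
    also have "\<dots> = map_mat (g i) (fam_mat N (x + y) (v i)) * M i"
      unfolding fam_mat_add real_hom_add_mat[OF hom(2)[OF i] fam_mat_carrier[of N] fam_mat_carrier[of N]]
      by (rule add_mult_distrib_mat[OF Z Z M[OF i], symmetric])
    finally show "D i * map_mat (f i) (fam_mat N (x + y) (u i))
      = map_mat (g i) (fam_mat N (x + y) (v i)) * M i" .
  qed
qed

text \<open>The block structure enters only through idempotents: \<open>Z k * E k\<close> is the
  first block column of \<open>Z k\<close>, padded by zeros. The assumptions \<open>DE\<close>,
  \<open>ME\<close> and \<open>ker\<close> are what \<open>projection_image_subset\<close> needs to
  compare the two spaces.\<close>

lemma intertwiner_projection:
  fixes P :: "'k \<Rightarrow> 'a::real_algebra_1 mat"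
  assumes S: "finite S" "span S = (UNIV :: 'a set)" and K: "finite K"
    and uv: "\<And>i. i \<in> I \<Longrightarrow> u i \<in> K" "\<And>i. i \<in> I \<Longrightarrow> v i \<in> K"
    and hom: "\<And>i. i \<in> I \<Longrightarrow> real_hom (f i)" "\<And>i. i \<in> I \<Longrightarrow> real_hom (g i)"
    and D: "\<And>i. i \<in> I \<Longrightarrow> D i \<in> carrier_mat (N (v i)) (N (u i))"
    and M: "\<And>i. i \<in> I \<Longrightarrow> M i \<in> carrier_mat (N (v i)) (N (u i))"
    and P: "\<And>k. k \<in> K \<Longrightarrow> P k \<in> carrier_mat (N k) (N k)"
    and Q: "\<And>k. k \<in> K \<Longrightarrow> Q k \<in> carrier_mat (N k) (N k)" "\<And>k. k \<in> K \<Longrightarrow> P k * Q k = 1\<^sub>m (N k)"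
    and eq: "\<And>i. i \<in> I \<Longrightarrow> D i * map_mat (f i) (P (u i)) = map_mat (g i) (P (v i)) * M i"
    and E: "\<And>k. k \<in> K \<Longrightarrow> E k \<in> carrier_mat (N k) (N k)" "\<And>k. k \<in> K \<Longrightarrow> E k * E k = E k"
    and fE: "\<And>i. i \<in> I \<Longrightarrow> map_mat (f i) (E (u i)) = E (u i)"
    and gE: "\<And>i. i \<in> I \<Longrightarrow> map_mat (g i) (E (v i)) = E (v i)"
    and DE: "\<And>i. i \<in> I \<Longrightarrow> D i * E (u i) = E (v i) * D i"
    and ME: "\<And>i. i \<in> I \<Longrightarrow> M i * E (u i) = D i * E (u i)"
    and ker: "\<And>i Y. i \<in> I \<Longrightarrow> Y \<in> carrier_mat (N (v i)) (N (v i)) \<Longrightarrow>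
        Y * E (v i) = 0\<^sub>m (N (v i)) (N (v i)) \<Longrightarrow> Y * M i = Y * D i"
  shows "\<exists>Z. (\<forall>k\<in>K. Z k \<in> carrier_mat (N k) (N k) \<and> Z k * E k = E k) \<and>
             (\<forall>i\<in>I. D i * map_mat (f i) (Z (u i)) = map_mat (g i) (Z (v i)) * M i)"
proof -
  define V0 where "V0 = intertwiners K N I u v f g D D"
  define V where "V = intertwiners K N I u v f g D M"
  define \<phi> where "\<phi> = fam_rmul K N P"
  define \<pi> where "\<pi> = fam_rmul K N E"
  have "finite (fam_supp K N)" using K by (auto simp: fam_supp_def)
  then obtain F where F: "finite F" "{w :: 'k \<times> nat \<times> nat \<Rightarrow> 'a. \<forall>i. i \<notin> fam_supp K N \<longrightarrow> w i = 0} \<subseteq> span F"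
    using finite_support_span[OF S] by blast
  have V0F: "V0 \<subseteq> span F" using F(2) by (auto simp: V0_def intertwiners_def)
  have subV0: "subspace V0" unfolding V0_def by (rule subspace_intertwiners) (use hom D in simp_all)
  have subV: "subspace V" unfolding V_def by (rule subspace_intertwiners) (use hom D M in simp_all)
  have lin\<phi>: "linear \<phi>" unfolding \<phi>_def by (rule linear_fam_rmul[OF P])
  have lin\<pi>: "linear \<pi>" unfolding \<pi>_def by (rule linear_fam_rmul[OF E(1)])
  have \<phi>: "fam_mat N (\<phi> w) k = fam_mat N w k * P k" if "k \<in> K" for w k
    unfolding \<phi>_def by (rule fam_mat_rmul, rule that, rule P[OF that])
  have \<pi>: "fam_mat N (\<pi> w) k = fam_mat N w k * E k" if "k \<in> K" for w k
    unfolding \<pi>_def by (rule fam_mat_rmul, rule that, rule E(1)[OF that])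
  have out: "\<phi> w i = 0" "\<pi> w i = 0" if "i \<notin> fam_supp K N" for w i
    using that unfolding \<phi>_def \<pi>_def fam_rmul_def by (auto intro: fam_of_outside)
  have f\<phi>: "map_mat (f i) (fam_mat N (\<phi> w) (u i)) = map_mat (f i) (fam_mat N w (u i)) * map_mat (f i) (P (u i))"
    and g\<phi>: "map_mat (g i) (fam_mat N (\<phi> w) (v i)) = map_mat (g i) (fam_mat N w (v i)) * map_mat (g i) (P (v i))"
    and f\<pi>: "map_mat (f i) (fam_mat N (\<pi> w) (u i)) = map_mat (f i) (fam_mat N w (u i)) * E (u i)"
    and g\<pi>: "map_mat (g i) (fam_mat N (\<pi> w) (v i)) = map_mat (g i) (fam_mat N w (v i)) * E (v i)"
    if i: "i \<in> I" for w i
    using real_hom_mult_mat[OF hom(1)[OF i] fam_mat_carrier[of N] P[OF uv(1)[OF i]]]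
      real_hom_mult_mat[OF hom(2)[OF i] fam_mat_carrier[of N] P[OF uv(2)[OF i]]]
      real_hom_mult_mat[OF hom(1)[OF i] fam_mat_carrier[of N] E(1)[OF uv(1)[OF i]]]
      real_hom_mult_mat[OF hom(2)[OF i] fam_mat_carrier[of N] E(1)[OF uv(2)[OF i]]]
    by (simp_all add: \<phi> \<pi> uv[OF i] fE[OF i] gE[OF i])
  have assoc: "X * Y * W = X * (Y * W)"
    if "X \<in> carrier_mat a b" "Y \<in> carrier_mat b c" "W \<in> carrier_mat c d" for X Y W :: "'a mat" and a b c d
    using that by (rule assoc_mult_mat)
  have Zf: "map_mat h (fam_mat N w k) \<in> carrier_mat (N k) (N k)" for h :: "'a \<Rightarrow> 'a" and w k
    by simp
  \<comment> \<open>Up to the entrywise maps, \<open>D Z = Z D\<close> and \<open>D P = P M\<close>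
    give \<open>D (Z P) = Z D P = (Z P) M\<close>.\<close>
  have \<phi>V: "\<phi> ` V0 \<subseteq> V"
  proof (rule image_subsetI)
    fix w assume w: "w \<in> V0"
    have "D i * map_mat (f i) (fam_mat N (\<phi> w) (u i)) = map_mat (g i) (fam_mat N (\<phi> w) (v i)) * M i"
      if i: "i \<in> I" for i
    proof -
      let ?f = "map_mat (f i) (fam_mat N w (u i))" and ?g = "map_mat (g i) (fam_mat N w (v i))"
      let ?fP = "map_mat (f i) (P (u i))" and ?gP = "map_mat (g i) (P (v i))"
      have fP: "?fP \<in> carrier_mat (N (u i)) (N (u i))" and gP: "?gP \<in> carrier_mat (N (v i)) (N (v i))"
        using P uv i by auto
      have "D i * (?f * ?fP) = D i * ?f * ?fP" by (rule assoc[OF D[OF i] Zf fP, symmetric])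
      also have "\<dots> = ?g * D i * ?fP" using w i by (simp add: V0_def intertwiners_def)
      also have "\<dots> = ?g * (?gP * M i)"
        unfolding eq[OF i, symmetric] by (rule assoc[OF Zf D[OF i] fP])
      also have "\<dots> = ?g * ?gP * M i" by (rule assoc[OF Zf gP M[OF i], symmetric])
      finally show ?thesis unfolding f\<phi>[OF i] g\<phi>[OF i] .
    qed
    then show "\<phi> w \<in> V" by (simp add: V_def intertwiners_def out)
  qed
  \<comment> \<open>The right inverses \<open>Q k\<close> recover \<open>w\<close> from
    \<open>\<phi> w\<close>.\<close>
  have inj: "inj_on \<phi> V0"
  proof (rule linear_inj_on_iff_eq_0[OF lin\<phi> subV0, THEN iffD2], intro ballI impI)
    fix w assume w: "w \<in> V0" "\<phi> w = 0"
    have "fam_mat N w k = fam_mat N 0 k" if k: "k \<in> K" for k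
    proof -
      have "fam_mat N w k = fam_mat N w k * (P k * Q k)"
        unfolding Q(2)[OF k] by (rule right_mult_one_mat[symmetric], rule fam_mat_carrier)
      also have "\<dots> = fam_mat N w k * P k * Q k"
        by (rule assoc[symmetric], rule fam_mat_carrier, rule P[OF k], rule Q(1)[OF k])
      also have "fam_mat N w k * P k = fam_mat N 0 k"
        using \<phi>[OF k, of w] w(2) by simp
      also have "fam_mat N 0 k = (0\<^sub>m (N k) (N k) :: 'a mat)"
        by (auto simp: fam_mat_def)
      also have "0\<^sub>m (N k) (N k) * Q k = 0\<^sub>m (N k) (N k)"
        by (rule left_mult_zero_mat[OF Q(1)[OF k]])
      finally show ?thesis by (auto simp: fam_mat_def)
    qed
    moreover have "w i = 0" if "i \<notin> fam_supp K N" for i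
      using w(1) that unfolding V0_def intertwiners_def by blast
    ultimately show "w = 0" by (intro fam_eqI[of K N w 0]) simp_all
  qed
  have idem: "\<pi> (\<pi> w) = \<pi> w" for w
  proof (rule fam_eqI[of K N])
    fix k assume k: "k \<in> K"
    have "fam_mat N w k * E k * E k = fam_mat N w k * (E k * E k)"
      by (rule assoc, rule fam_mat_carrier, rule E(1)[OF k], rule E(1)[OF k])
    then show "fam_mat N (\<pi> (\<pi> w)) k = fam_mat N (\<pi> w) k"
      by (simp add: \<pi>[OF k] E(2)[OF k])
  qed (simp_all add: out)
  \<comment> \<open>By \<open>ME\<close> the first block column does not see the difference between
    \<open>M\<close> and \<open>D\<close>, and by \<open>DE\<close> the idempotent moves past
    \<open>D\<close>.\<close>
  have \<pi>V: "\<pi> ` V \<subseteq> V0"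
  proof (rule image_subsetI)
    fix w assume w: "w \<in> V"
    have "D i * map_mat (f i) (fam_mat N (\<pi> w) (u i)) = map_mat (g i) (fam_mat N (\<pi> w) (v i)) * D i"
      if i: "i \<in> I" for i
    proof -
      let ?f = "map_mat (f i) (fam_mat N w (u i))" and ?g = "map_mat (g i) (fam_mat N w (v i))"
      note Eu = E(1)[OF uv(1)[OF i]] and Ev = E(1)[OF uv(2)[OF i]]
      have "D i * (?f * E (u i)) = D i * ?f * E (u i)" by (rule assoc[OF D[OF i] Zf Eu, symmetric])
      also have "\<dots> = ?g * M i * E (u i)" using w i by (simp add: V_def intertwiners_def)
      also have "\<dots> = ?g * (E (v i) * D i)"
        unfolding DE[OF i, symmetric] ME[OF i, symmetric] by (rule assoc[OF Zf M[OF i] Eu])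
      also have "\<dots> = ?g * E (v i) * D i" by (rule assoc[OF Zf Ev D[OF i], symmetric])
      finally show ?thesis unfolding f\<pi>[OF i] g\<pi>[OF i] .
    qed
    then show "\<pi> w \<in> V0" by (simp add: V0_def intertwiners_def out)
  qed
  have kerV: "w \<in> V0" if w: "w \<in> V" "\<pi> w = 0" for w
  proof -
    have "D i * map_mat (f i) (fam_mat N w (u i)) = map_mat (g i) (fam_mat N w (v i)) * D i"
      if i: "i \<in> I" for i
    proof -
      have "map_mat (g i) (fam_mat N w (v i)) * E (v i) = map_mat (g i) (fam_mat N 0 (v i))"
        using g\<pi>[OF i, of w] w(2) by simp
      also have "\<dots> = 0\<^sub>m (N (v i)) (N (v i))"
        using real_hom_0[OF hom(2)[OF i]] by (auto simp: fam_mat_def)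
      finally have "map_mat (g i) (fam_mat N w (v i)) * M i = map_mat (g i) (fam_mat N w (v i)) * D i"
        by (rule ker[OF i Zf])
      then show ?thesis using w(1) i by (simp add: V_def intertwiners_def)
    qed
    then show ?thesis using w(1) by (simp add: V0_def V_def intertwiners_def)
  qed
  \<comment> \<open>The family of idempotents lies in \<open>V0\<close> by \<open>DE\<close>. Hence
    its projection is also attained by a member of \<open>V\<close>, which is the required
    \<open>Z\<close>.\<close>
  define e where "e = fam_of K N E"
  have e: "fam_mat N e k = E k" if "k \<in> K" for k
    unfolding e_def by (rule fam_mat_of, rule that, rule E(1)[OF that])
  have "e \<in> V0"
    unfolding V0_def intertwiners_def
    using e uv fE gE DE by (auto simp: e_def fam_of_outside)
  then have "\<pi> e \<in> \<pi> ` V"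
    using projection_image_subset[OF subV0 V0F F(1) subV lin\<phi> inj \<phi>V lin\<pi> idem \<pi>V kerV]
    by (simp add: image_subset_iff)
  then obtain w where w: "\<pi> w = \<pi> e" "w \<in> V" by (metis imageE)
  have "fam_mat N w k * E k = E k" if k: "k \<in> K" for k
    using \<pi>[OF k, of w] \<pi>[OF k, of e] w(1) e[OF k] E(2)[OF k] by simp
  then show ?thesis
    using w(2) by (intro exI[of _ "fam_mat N w"]) (auto simp: V_def intertwiners_def)
qed

lemma four_block_mat_upper_right_eqD:
  assumes eq: "four_block_mat A B C D = four_block_mat A' B' C' D'"
    and c: "A \<in> carrier_mat r c" "B \<in> carrier_mat r c'" "D \<in> carrier_mat r' c'"
      "A' \<in> carrier_mat r c" "B' \<in> carrier_mat r c'" "D' \<in> carrier_mat r' c'"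
  shows "B = B'"
proof (rule eq_matI)
  fix i j assume "i < dim_row B'" "j < dim_col B'"
  then have ij: "i < r" "j < c'" using c by auto
  have "B $$ (i, j) = four_block_mat A B C D $$ (i, c + j)"
    using ij c by simp
  also have "\<dots> = B' $$ (i, j)"
    unfolding eq using ij c by simp
  finally show "B $$ (i, j) = B' $$ (i, j)" .
qed (use c in simp_all)

text \<open>A family \<open>Z\<close> with first block column \<open>(I, 0)\<close> is block upper
  triangular. If \<open>X\<close> is its upper right block, comparing the upper right blocks in the
  intertwining equation gives \<open>A f(X) = C + g(X) B\<close>.\<close>

lemma roth_system:
  fixes P :: "'k \<Rightarrow> 'a::real_algebra_1 mat"
  assumes S: "finite S" "span S = (UNIV :: 'a set)" and K: "finite K"
    and uv: "\<And>i. i \<in> I \<Longrightarrow> u i \<in> K" "\<And>i. i \<in> I \<Longrightarrow> v i \<in> K"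
    and hom: "\<And>i. i \<in> I \<Longrightarrow> real_hom (f i)" "\<And>i. i \<in> I \<Longrightarrow> real_hom (g i)"
    and A: "\<And>i. i \<in> I \<Longrightarrow> A i \<in> carrier_mat (p (v i)) (p (u i))"
    and B: "\<And>i. i \<in> I \<Longrightarrow> B i \<in> carrier_mat (q (v i)) (q (u i))"
    and C: "\<And>i. i \<in> I \<Longrightarrow> C i \<in> carrier_mat (p (v i)) (q (u i))"
    and P: "\<And>k. k \<in> K \<Longrightarrow> P k \<in> carrier_mat (p k + q k) (p k + q k)"
    and Q: "\<And>k. k \<in> K \<Longrightarrow> Q k \<in> carrier_mat (p k + q k) (p k + q k)"
      "\<And>k. k \<in> K \<Longrightarrow> P k * Q k = 1\<^sub>m (p k + q k)"
    and eq: "\<And>i. i \<in> I \<Longrightarrow>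
      four_block_mat (A i) (0\<^sub>m (p (v i)) (q (u i))) (0\<^sub>m (q (v i)) (p (u i))) (B i) * map_mat (f i) (P (u i))
      = map_mat (g i) (P (v i)) * four_block_mat (A i) (C i) (0\<^sub>m (q (v i)) (p (u i))) (B i)"
  shows "\<exists>X. (\<forall>k\<in>K. X k \<in> carrier_mat (p k) (q k)) \<and>
    (\<forall>i\<in>I. A i * map_mat (f i) (X (u i)) - map_mat (g i) (X (v i)) * B i = C i)"
proof -
  define D where "D i = four_block_mat (A i) (0\<^sub>m (p (v i)) (q (u i))) (0\<^sub>m (q (v i)) (p (u i))) (B i)" for i
  define M where "M i = four_block_mat (A i) (C i) (0\<^sub>m (q (v i)) (p (u i))) (B i)" for i
  \<comment> \<open>Right multiplication by \<open>E\<close> keeps the first block column, right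
    multiplication by \<open>F\<close> the second.\<close>
  define E where "E k = four_block_mat (1\<^sub>m (p k)) (0\<^sub>m (p k) (q k)) (0\<^sub>m (q k) (p k)) (0\<^sub>m (q k) (q k) :: 'a mat)" for k
  define F where "F k = four_block_mat (0\<^sub>m (p k) (p k)) (0\<^sub>m (p k) (q k)) (0\<^sub>m (q k) (p k)) (1\<^sub>m (q k) :: 'a mat)" for k
  define N where "N k = p k + q k" for k
  have Dc: "D i \<in> carrier_mat (N (v i)) (N (u i))" and Mc: "M i \<in> carrier_mat (N (v i)) (N (u i))"
    if "i \<in> I" for i
    using A[OF that] B[OF that] by (auto simp: D_def M_def N_def)
  have Ec: "E k \<in> carrier_mat (N k) (N k)" and Fc: "F k \<in> carrier_mat (N k) (N k)" for k
    by (simp_all add: E_def F_def N_def)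
  have EE: "E k * E k = E k" for k
    unfolding E_def by (subst mult_four_block_mat) auto
  have EF: "E k + F k = 1\<^sub>m (N k)" for k
    unfolding E_def F_def N_def
    by (subst add_four_block_mat) (auto simp flip: four_block_one_mat)
  have hE: "map_mat h (E k) = E k" if "real_hom h" for h :: "'a \<Rightarrow> 'a" and k
    using real_hom_0[OF that] real_hom_1[OF that] unfolding E_def
    by (intro eq_matI) auto
  have blocks: "D i * E (u i) = E (v i) * D i" "M i * E (u i) = D i * E (u i)" "F (v i) * M i = F (v i) * D i"
    if i: "i \<in> I" for i
  proof -
    note right = mult_four_block_mat[of _ "p (v i)" "p (u i)" _ "q (u i)" _ "q (v i)" _ _ "p (u i)" _ "q (u i)"]
    note left = mult_four_block_mat[of _ "p (v i)" "p (v i)" _ "q (v i)" _ "q (v i)" _ _ "p (u i)" _ "q (u i)"]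
    have "D i * E (u i) = four_block_mat (A i) (0\<^sub>m (p (v i)) (q (u i))) (0\<^sub>m (q (v i)) (p (u i))) (0\<^sub>m (q (v i)) (q (u i)))"
      and "M i * E (u i) = four_block_mat (A i) (0\<^sub>m (p (v i)) (q (u i))) (0\<^sub>m (q (v i)) (p (u i))) (0\<^sub>m (q (v i)) (q (u i)))"
      unfolding D_def M_def E_def using A[OF i] B[OF i] C[OF i] by (simp_all add: right)
    moreover have "E (v i) * D i = four_block_mat (A i) (0\<^sub>m (p (v i)) (q (u i))) (0\<^sub>m (q (v i)) (p (u i))) (0\<^sub>m (q (v i)) (q (u i)))"
      unfolding D_def E_def using A[OF i] B[OF i] by (simp add: left)
    moreover have "F (v i) * D i = F (v i) * M i"
      unfolding D_def M_def F_def using A[OF i] B[OF i] C[OF i] by (simp add: left)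
    ultimately show "D i * E (u i) = E (v i) * D i" "M i * E (u i) = D i * E (u i)"
      "F (v i) * M i = F (v i) * D i" by simp_all
  qed
  \<comment> \<open>If the first block column of \<open>Y\<close> vanishes, then
    \<open>Y = Y F\<close>; and \<open>F M = F D\<close> because \<open>M\<close> and
    \<open>D\<close> have the same lower block row.\<close>
  have ker: "Y * M i = Y * D i"
    if i: "i \<in> I" and Y: "Y \<in> carrier_mat (N (v i)) (N (v i))"
      and YE: "Y * E (v i) = 0\<^sub>m (N (v i)) (N (v i))" for i Y
  proof -
    have "Y = Y * (E (v i) + F (v i))" using Y by (simp add: EF)
    also have "\<dots> = Y * E (v i) + Y * F (v i)" by (rule mult_add_distrib_mat[OF Y Ec Fc])
    also have "\<dots> = Y * F (v i)" using YE Y Fc[of "v i"] by simp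
    finally have YF: "Y = Y * F (v i)" .
    have "Y * M i = Y * (F (v i) * M i)"
      using YF assoc_mult_mat[OF Y Fc Mc[OF i]] by simp
    also have "\<dots> = Y * D i"
      unfolding blocks(3)[OF i] using YF assoc_mult_mat[OF Y Fc Dc[OF i]] by simp
    finally show ?thesis .
  qed
  have "\<exists>Z. (\<forall>k\<in>K. Z k \<in> carrier_mat (N k) (N k) \<and> Z k * E k = E k) \<and>
             (\<forall>i\<in>I. D i * map_mat (f i) (Z (u i)) = map_mat (g i) (Z (v i)) * M i)"
  proof (rule intertwiner_projection[OF S K uv hom Dc Mc])
    show "P k \<in> carrier_mat (N k) (N k)" "Q k \<in> carrier_mat (N k) (N k)" "P k * Q k = 1\<^sub>m (N k)"
      if "k \<in> K" for k
      using P[OF that] Q[OF that] by (simp_all add: N_def)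
    show "D i * map_mat (f i) (P (u i)) = map_mat (g i) (P (v i)) * M i" if "i \<in> I" for i
      using eq[OF that] by (simp add: D_def M_def)
  qed (use Ec EE hE hom blocks ker in \<open>simp_all\<close>)
  then obtain Z where Z: "\<And>k. k \<in> K \<Longrightarrow> Z k \<in> carrier_mat (N k) (N k)" "\<And>k. k \<in> K \<Longrightarrow> Z k * E k = E k"
    and DZ: "\<And>i. i \<in> I \<Longrightarrow> D i * map_mat (f i) (Z (u i)) = map_mat (g i) (Z (v i)) * M i"
    by blast
  define X where "X k = mat (p k) (q k) (\<lambda>(r, c). Z k $$ (r, p k + c))" for k
  define W where "W k = mat (q k) (q k) (\<lambda>(r, c). Z k $$ (p k + r, p k + c))" for k
  have X: "X k \<in> carrier_mat (p k) (q k)" and W: "W k \<in> carrier_mat (q k) (q k)" for k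
    by (simp_all add: X_def W_def)
  \<comment> \<open>The condition \<open>Z E = E\<close> determines the first \<open>p k\<close>
    columns; the remaining columns are by definition \<open>X\<close> and \<open>W\<close>.\<close>
  have Zb: "Z k = four_block_mat (1\<^sub>m (p k)) (X k) (0\<^sub>m (q k) (p k)) (W k)" if k: "k \<in> K" for k
  proof (rule eq_matI)
    fix r c assume "r < dim_row (four_block_mat (1\<^sub>m (p k)) (X k) (0\<^sub>m (q k) (p k)) (W k))"
      "c < dim_col (four_block_mat (1\<^sub>m (p k)) (X k) (0\<^sub>m (q k) (p k)) (W k))"
    then have rc: "r < N k" "c < N k" using W[of k] by (auto simp: N_def)
    have col: "Z k $$ (r, c) = E k $$ (r, c)" if "c < p k"
    proof -
      have "(Z k * E k) $$ (r, c) = (\<Sum>j<N k. Z k $$ (r, j) * E k $$ (j, c))"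
        using rc Z(1)[OF k] Ec[of k] by (auto simp: scalar_prod_def atLeast0LessThan)
      also have "\<dots> = (\<Sum>j<N k. if j = c then Z k $$ (r, j) else 0)"
        using that by (intro sum.cong) (auto simp: E_def N_def)
      also have "\<dots> = Z k $$ (r, c)" using rc by simp
      finally show ?thesis using Z(2)[OF k] by simp
    qed
    show "Z k $$ (r, c) = four_block_mat (1\<^sub>m (p k)) (X k) (0\<^sub>m (q k) (p k)) (W k) $$ (r, c)"
      using rc col X[of k] W[of k] by (auto simp: N_def E_def X_def W_def)
  qed (use Z(1)[OF k] W[of k] in \<open>auto simp: N_def\<close>)
  have "A i * map_mat (f i) (X (u i)) - map_mat (g i) (X (v i)) * B i = C i" if i: "i \<in> I" for i
  proof -
    have hZ: "map_mat h (Z k) = four_block_mat (1\<^sub>m (p k)) (map_mat h (X k)) (0\<^sub>m (q k) (p k)) (map_mat h (W k))"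
      if k: "k \<in> K" and h: "real_hom h" for h k
      unfolding Zb[OF k] using X[of k] W[of k] real_hom_0[OF h] real_hom_1[OF h]
      by (intro eq_matI) auto
    let ?fX = "map_mat (f i) (X (u i))" and ?gX = "map_mat (g i) (X (v i))"
    let ?fW = "map_mat (f i) (W (u i))" and ?gW = "map_mat (g i) (W (v i))"
    have c: "?fX \<in> carrier_mat (p (u i)) (q (u i))" "?gX \<in> carrier_mat (p (v i)) (q (v i))"
      "?fW \<in> carrier_mat (q (u i)) (q (u i))" "?gW \<in> carrier_mat (q (v i)) (q (v i))"
      using X W by simp_all
    have "four_block_mat (A i) (A i * ?fX) (0\<^sub>m (q (v i)) (p (u i))) (B i * ?fW)
        = D i * map_mat (f i) (Z (u i))"
      unfolding D_def hZ[OF uv(1)[OF i] hom(1)[OF i]]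
      by (subst mult_four_block_mat[OF A[OF i] _ _ B[OF i] _ c(1) _ c(3)])
        (use A[OF i] B[OF i] c in auto)
    also have "\<dots> = four_block_mat (A i) (C i + ?gX * B i) (0\<^sub>m (q (v i)) (p (u i))) (?gW * B i)"
      unfolding DZ[OF i] M_def hZ[OF uv(2)[OF i] hom(2)[OF i]]
      by (subst mult_four_block_mat[OF _ c(2) _ c(4) A[OF i] C[OF i] _ B[OF i]])
        (use A[OF i] B[OF i] C[OF i] c in auto)
    finally have "A i * ?fX = C i + ?gX * B i"
      by (rule four_block_mat_upper_right_eqD) (use A[OF i] B[OF i] C[OF i] c in auto)
    then show ?thesis using C[OF i] c B[OF i] by (intro eq_matI) auto
  qed
  then show ?thesis using X by blast
qed

section \<open>Inverses and duals\<close>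

text \<open>Carries the size and both products along with an explicit inverse, so that inverses can
  be handled without determinants over a noncommutative ring.\<close>

definition inverse_pair :: "nat \<Rightarrow> 'a::semiring_1 mat \<Rightarrow> 'a mat \<Rightarrow> bool" where
  "inverse_pair N P Q \<longleftrightarrow> P \<in> carrier_mat N N \<and> Q \<in> carrier_mat N N \<and> P * Q = 1\<^sub>m N \<and> Q * P = 1\<^sub>m N"

lemma inverse_pairD:
  assumes "inverse_pair N P Q"
  shows "P \<in> carrier_mat N N" "Q \<in> carrier_mat N N" "P * Q = 1\<^sub>m N" "Q * P = 1\<^sub>m N"
  using assms by (simp_all add: inverse_pair_def)

lemma inverse_pair_sym: "inverse_pair N P Q \<longleftrightarrow> inverse_pair N Q P"
  by (auto simp: inverse_pair_def)

lemma square_invertible_inverts: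
  assumes P: "P \<in> carrier_mat N N" and B: "inverts_mat P B" "inverts_mat B P"
  shows "inverse_pair N P B"
proof -
  have "P * B = 1\<^sub>m N" "B * P = 1\<^sub>m (dim_row B)"
    using B P by (auto simp: inverts_mat_def)
  \<comment> \<open>\<open>inverts_mat B P\<close> refers to the identity of size
    \<open>dim_row B\<close>; comparing column counts in both products forces \<open>B\<close> to be
    \<open>N\<close> by \<open>N\<close>.\<close>
  moreover from this have "dim_col B = N" "dim_row B = N"
    using P by (metis carrier_matD(2) index_mult_mat(3) index_one_mat(3))+
  ultimately show ?thesis using P by (auto simp: inverse_pair_def)
qed

lemma inverse_pair_unique:
  assumes PQ: "inverse_pair N P Q" and PB: "inverse_pair N P B"
  shows "B = Q"
proof -
  note q = inverse_pairD[OF PQ] and b = inverse_pairD[OF PB]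
  have "B = B * (P * Q)" using q(3) b(2) by simp
  also have "\<dots> = B * P * Q" by (rule assoc_mult_mat[OF b(2) q(1,2), symmetric])
  also have "\<dots> = Q" using b(4) q(2) by simp
  finally show ?thesis .
qed

lemma inv_mat_eqI:
  assumes "inverse_pair N P Q"
  shows "inv_mat P = Q"
  unfolding inv_mat_def
proof (rule the_equality)
  show "inverts_mat P Q \<and> inverts_mat Q P"
    using assms by (auto simp: inverse_pair_def inverts_mat_def)
  fix B assume "inverts_mat P B \<and> inverts_mat B P"
  then have "inverse_pair N P B"
    using assms by (intro square_invertible_inverts) (auto simp: inverse_pair_def)
  then show "B = Q" using inverse_pair_unique assms by blast
qed

lemma invertible_mat_inverse_pair:
  assumes "P \<in> carrier_mat N N"
  shows "invertible_mat P \<longleftrightarrow> (\<exists>Q. inverse_pair N P Q)"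
proof
  assume "invertible_mat P"
  then show "\<exists>Q. inverse_pair N P Q"
    using square_invertible_inverts[OF assms] by (auto simp: invertible_mat_def)
next
  assume "\<exists>Q. inverse_pair N P Q"
  then show "invertible_mat P"
    using assms by (auto simp: invertible_mat_def inverse_pair_def inverts_mat_def)
qed

lemma inverse_pair_mult:
  assumes "inverse_pair N P Q" "inverse_pair N P' Q'"
  shows "inverse_pair N (P * P') (Q' * Q)"
proof -
  note c = inverse_pairD[OF assms(1)] inverse_pairD[OF assms(2)]
  have a: "X * Y * Z = X * (Y * Z)" if "X \<in> carrier_mat N N" "Y \<in> carrier_mat N N" "Z \<in> carrier_mat N N"
    for X Y Z :: "'a mat" using that by (rule assoc_mult_mat)
  have "P * P' * (Q' * Q) = P * (P' * (Q' * Q))" "Q' * Q * (P * P') = Q' * (Q * (P * P'))"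
    by (rule a; use c in simp)+
  moreover have "P' * (Q' * Q) = Q" "Q * (P * P') = P'"
    using c a[of P' Q' Q] a[of Q P P'] by simp_all
  ultimately show ?thesis using c by (auto simp: inverse_pair_def)
qed

lemma uminus_zero_mat [simp]: "- 0\<^sub>m n k = (0\<^sub>m n k :: 'a::group_add mat)"
  by (rule eq_matI) auto

definition J_inv :: "nat \<Rightarrow> nat \<Rightarrow> 'a::ring_1 mat" where
  "J_inv m n = four_block_mat (0\<^sub>m m n) (- 1\<^sub>m m) (1\<^sub>m n) (0\<^sub>m n m)"

lemma J_carrier:
  "(J_mat m n :: 'a::ring_1 mat) \<in> carrier_mat (m + n) (m + n)"
  "(J_inv m n :: 'a::ring_1 mat) \<in> carrier_mat (m + n) (m + n)"
  by (auto simp: J_mat_def J_inv_def add.commute)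

lemma J_inverse_pair: "inverse_pair (m + n) (J_mat m n :: 'a::ring_1 mat) (J_inv m n)"
proof -
  have "J_mat m n * J_inv m n = (1\<^sub>m (n + m) :: 'a mat)"
    unfolding J_mat_def J_inv_def
    by (simp add: mult_four_block_mat[of _ n m _ n _ m _ _ n _ m])
  moreover have "J_inv m n * J_mat m n = (1\<^sub>m (m + n) :: 'a mat)"
    unfolding J_mat_def J_inv_def
    by (simp add: mult_four_block_mat[of _ m n _ m _ n _ _ m _ n])
  ultimately show ?thesis
    using J_carrier by (auto simp: inverse_pair_def add.commute)
qed

text \<open>Exchanging the block sizes turns \<open>J\<close> into its inverse up to sign. The sign
  disappears under conjugation, where it occurs twice.\<close>

lemma J_mat_swap: "J_mat n m = - (J_inv m n :: 'a::ring_1 mat)"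
  "J_inv n m = - (J_mat m n :: 'a::ring_1 mat)"
  unfolding J_mat_def J_inv_def by (intro eq_matI; auto)+

section \<open>Systems over an algebra with involutions\<close>

definition contra :: "exponent \<Rightarrow> bool" where
  "contra \<sigma> \<longleftrightarrow> \<sigma> \<notin> {Ident, Compl}"

definition flip_size :: "bool \<Rightarrow> nat \<Rightarrow> nat \<Rightarrow> nat" where
  "flip_size b k l = (if b then l else k)"

lemma op_rows_flip: "op_rows \<sigma> k l = flip_size (contra \<sigma>) k l"
  and op_cols_flip: "op_cols \<sigma> k l = flip_size (contra \<sigma>) l k"
  by (auto simp: op_rows_def op_cols_def flip_size_def contra_def)

lemma flip_size_add: "flip_size b k l + flip_size b l k = k + l"
  by (simp add: flip_size_def)

lemma inverse_pair_unipotent: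
  fixes X :: "'a::ring_1 mat"
  assumes X: "X \<in> carrier_mat k l"
  shows "inverse_pair (k + l) (four_block_mat (1\<^sub>m k) X (0\<^sub>m l k) (1\<^sub>m l))
    (four_block_mat (1\<^sub>m k) (- X) (0\<^sub>m l k) (1\<^sub>m l))"
proof -
  have "- X + X = 0\<^sub>m k l" "X + - X = 0\<^sub>m k l" "X - X = 0\<^sub>m k l" using X by (auto intro!: eq_matI)
  then show ?thesis
    unfolding inverse_pair_def using X
    by (auto simp: mult_four_block_mat[of _ k k _ l _ l _ _ k _ l])
qed

text \<open>Common setting for the three scalar domains: \<open>c\<close> is an involutive
  automorphism, \<open>d\<close> an involutive anti-automorphism, and they commute. Finite dimension
  over the reals is what the dimension count rests on.\<close>

locale involutive_algebra =
  fixes c d :: "'a::real_algebra_1 \<Rightarrow> 'a"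
  assumes c: "real_hom c" "c (c x) = x"
    and d: "linear d" "d 1 = 1" "d (x * y) = d y * d x" "d (d x) = x"
    and cd: "c (d x) = d (c x)"
    and finite_dim: "\<exists>S :: 'a set. finite S \<and> span S = UNIV"
begin

definition cj :: "exponent \<Rightarrow> 'a \<Rightarrow> 'a" where
  "cj \<sigma> = (if \<sigma> \<in> {Compl, Star} then c else id)"

definition adj :: "'a mat \<Rightarrow> 'a mat" where
  "adj A = transpose_mat (map_mat d A)"

text \<open>Every exponent splits into an optional entrywise conjugation and an optional adjoint.
  \<open>Transp\<close> and \<open>Dagger\<close> both become \<open>adj\<close>, which is the plain
  transpose when \<open>d\<close> is the identity.\<close>

definition gen_op :: "exponent \<Rightarrow> 'a mat \<Rightarrow> 'a mat" where
  "gen_op \<sigma> A = (if contra \<sigma> then adj (map_mat (cj \<sigma>) A) else map_mat (cj \<sigma>) A)"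

text \<open>This is the angle operation of a transposing exponent with the conjugation left
  out.\<close>

definition dual :: "nat \<Rightarrow> nat \<Rightarrow> 'a mat \<Rightarrow> 'a mat" where
  "dual m n P = J_mat m n * adj (inv_mat P) * J_inv m n"

definition twist :: "bool \<Rightarrow> nat \<Rightarrow> nat \<Rightarrow> 'a mat \<Rightarrow> 'a mat" where
  "twist b m n P = (if b then dual m n P else P)"

lemma real_hom_cj: "real_hom (cj \<sigma>)"
  using c(1) by (auto simp: cj_def real_hom_def linear_id[unfolded id_def] id_def)

lemma cj_d: "cj \<sigma> (d x) = d (cj \<sigma> x)"
  by (simp add: cj_def cd)

lemma adj_carrier: "A \<in> carrier_mat r k \<Longrightarrow> adj A \<in> carrier_mat k r"
  by (simp add: adj_def)

lemma dim_adj [simp]: "dim_row (adj A) = dim_col A" "dim_col (adj A) = dim_row A"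
  by (simp_all add: adj_def)

lemma adj_index [simp]: "i < dim_col A \<Longrightarrow> j < dim_row A \<Longrightarrow> adj A $$ (i, j) = d (A $$ (j, i))"
  by (simp add: adj_def)

lemma adj_adj [simp]: "adj (adj A) = A"
  by (rule eq_matI) (simp_all add: d)

lemma adj_mult:
  assumes "A \<in> carrier_mat r k" "B \<in> carrier_mat k l"
  shows "adj (A * B) = adj B * adj A"
proof (rule eq_matI)
  fix i j assume ij: "i < dim_row (adj B * adj A)" "j < dim_col (adj B * adj A)"
  then have ij': "i < l" "j < r" using assms by auto
  have "adj (A * B) $$ (i, j) = d (\<Sum>x\<in>{0..<k}. A $$ (j, x) * B $$ (x, i))"
    using assms ij' by (simp add: scalar_prod_def)
  also have "\<dots> = (\<Sum>x\<in>{0..<k}. d (B $$ (x, i)) * d (A $$ (j, x)))"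
    by (simp add: linear_sum[OF d(1)] d(3))
  also have "\<dots> = (adj B * adj A) $$ (i, j)"
    using assms ij' by (simp add: scalar_prod_def)
  finally show "adj (A * B) $$ (i, j) = (adj B * adj A) $$ (i, j)" .
qed (use assms in auto)

lemma d_uminus: "d (- x) = - d x"
  by (rule linear_neg[OF d(1)])

lemma d_0: "d 0 = 0"
  by (rule linear_0[OF d(1)])

lemma adj_one [simp]: "adj (1\<^sub>m k) = 1\<^sub>m k"
  by (rule eq_matI) (auto simp: d d_0)

lemma adj_zero [simp]: "adj (0\<^sub>m k l) = 0\<^sub>m l k"
  by (rule eq_matI) (auto simp: d_0)

lemma adj_uminus [simp]: "adj (- A) = - adj A"
  by (rule eq_matI) (auto simp: d_uminus)

lemma map_cj_adj: "map_mat (cj \<sigma>) (adj A) = adj (map_mat (cj \<sigma>) A)"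
  by (rule eq_matI) (auto simp: cj_d)

lemma adj_four_block_mat:
  assumes "A \<in> carrier_mat r k" "B \<in> carrier_mat r k'" "C \<in> carrier_mat r' k" "D \<in> carrier_mat r' k'"
  shows "adj (four_block_mat A B C D) = four_block_mat (adj A) (adj C) (adj B) (adj D)"
  unfolding adj_def map_four_block_mat[OF assms]
  by (rule transpose_four_block_mat) (use assms in auto)

lemma inverse_pair_adj: "inverse_pair N P Q \<Longrightarrow> inverse_pair N (adj P) (adj Q)"
  unfolding inverse_pair_def by (metis adj_carrier adj_mult adj_one)

lemma inverse_pair_map_cj:
  assumes "inverse_pair N P Q"
  shows "inverse_pair N (map_mat (cj \<sigma>) P) (map_mat (cj \<sigma>) Q)"
proof -
  have "map_mat (cj \<sigma>) (1\<^sub>m N) = 1\<^sub>m N"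
    by (rule eq_matI) (auto simp: real_hom_1[OF real_hom_cj] real_hom_0[OF real_hom_cj])
  then show ?thesis
    using assms unfolding inverse_pair_def
    by (metis map_carrier_mat real_hom_mult_mat[OF real_hom_cj])
qed

lemma adj_J: "adj (J_mat m n) = J_inv m n" "adj (J_inv m n) = J_mat m n"
  unfolding J_mat_def J_inv_def
  by (simp_all add: adj_four_block_mat[of _ n m _ n _ m] adj_four_block_mat[of _ m n _ m _ n])

lemma map_cj_J: "map_mat (cj \<sigma>) (J_mat m n) = J_mat m n" "map_mat (cj \<sigma>) (J_inv m n) = J_inv m n"
  unfolding J_mat_def J_inv_def
  using real_hom_1[OF real_hom_cj] real_hom_0[OF real_hom_cj] linear_neg[of "cj \<sigma>"] real_hom_cj[of \<sigma>]
  by (intro eq_matI; auto simp: real_hom_def)+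

lemma dual_eq:
  assumes "inverse_pair (m + n) P Q"
  shows "dual m n P = J_mat m n * adj Q * J_inv m n"
  unfolding dual_def inv_mat_eqI[OF assms] ..

lemma inverse_pair_dual:
  assumes "inverse_pair (m + n) P Q"
  shows "inverse_pair (m + n) (dual m n P) (J_mat m n * adj P * J_inv m n)"
proof -
  have "inverse_pair (m + n) (J_mat m n * adj Q * J_inv m n) (J_mat m n * (adj P * J_inv m n))"
    using inverse_pair_mult[OF inverse_pair_mult[OF J_inverse_pair inverse_pair_adj]]
      J_inverse_pair assms inverse_pair_sym by blast
  moreover have "J_mat m n * (adj P * J_inv m n) = J_mat m n * adj P * J_inv m n"
    using assms J_carrier[of m n] adj_carrier[of P "m + n" "m + n"]
    by (intro assoc_mult_mat[symmetric]) (auto simp: inverse_pair_def)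
  ultimately show ?thesis using dual_eq[OF assms] by simp
qed

text \<open>The inverse of the dual is \<open>J (adj P) J^-1\<close>, and since \<open>adj\<close>
  exchanges \<open>J\<close> and \<open>J^-1\<close>, its adjoint is \<open>J P J^-1\<close>. The
  second conjugation undoes the first. Sizes are exchanged because the adjoint unknown has
  transposed size.\<close>

lemma dual_dual:
  assumes P: "inverse_pair (m + n) P Q"
  shows "dual n m (dual m n P) = P"
proof -
  let ?N = "m + n"
  have a: "X * Y * Z = X * (Y * Z)" if "X \<in> carrier_mat ?N ?N" "Y \<in> carrier_mat ?N ?N" "Z \<in> carrier_mat ?N ?N"
    for X Y Z :: "'a mat" using that by (rule assoc_mult_mat)
  have Pc: "P \<in> carrier_mat ?N ?N" using P by (simp add: inverse_pair_def)
  have J: "(J_mat m n :: 'a mat) \<in> carrier_mat ?N ?N" "(J_inv m n :: 'a mat) \<in> carrier_mat ?N ?N"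
    by (rule J_carrier)+
  note Ji = J_inverse_pair[of m n, where 'a = 'a, THEN inverse_pairD(4)]
  have "dual n m (dual m n P) = J_mat n m * adj (J_mat m n * adj P * J_inv m n) * J_inv n m"
    using inverse_pair_dual[OF P] by (intro dual_eq) (simp add: add.commute)
  also have "adj (J_mat m n * adj P * J_inv m n) = J_mat m n * (P * J_inv m n)"
    using J Pc adj_carrier[OF Pc]
    by (subst adj_mult[of _ ?N ?N _ ?N], simp, simp, subst adj_mult[of _ ?N ?N _ ?N]) (simp_all add: adj_J)
  \<comment> \<open>The signs from \<open>J_mat_swap\<close> on the left and on the right
    cancel.\<close>
  also have "J_mat n m * (J_mat m n * (P * J_inv m n)) * J_inv n m
      = J_inv m n * (J_mat m n * (P * J_inv m n)) * J_mat m n"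
    using J Pc unfolding J_mat_swap[of n m] by (subst uminus_mult_left_mat; simp)+
  also have "\<dots> = (J_inv m n * J_mat m n) * P * (J_inv m n * J_mat m n)"
    using J Pc by (simp add: a)
  also have "\<dots> = P" using Pc Ji by simp
  finally show ?thesis .
qed

text \<open>Conjugation commutes with inversion and with \<open>adj\<close>, and it fixes
  \<open>J\<close>, whose entries are 0, 1 and -1.\<close>

lemma map_cj_dual:
  assumes "inverse_pair (m + n) P Q"
  shows "map_mat (cj \<sigma>) (dual m n P) = dual m n (map_mat (cj \<sigma>) P)"
proof -
  note J = J_carrier[of m n, where 'a = 'a]
  have Q: "adj Q \<in> carrier_mat (m + n) (m + n)"
    using assms by (auto simp: inverse_pair_def intro: adj_carrier)
  show ?thesis
    unfolding dual_eq[OF assms] dual_eq[OF inverse_pair_map_cj[OF assms]]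
      real_hom_mult_mat[OF real_hom_cj mult_carrier_mat[OF J(1) Q] J(2)]
      real_hom_mult_mat[OF real_hom_cj J(1) Q]
    by (simp add: map_cj_J map_cj_adj)
qed

lemma inverse_pair_twist:
  assumes "inverse_pair (m + n) P Q"
  shows "\<exists>Q'. inverse_pair (m + n) (twist b m n P) Q'"
  using assms inverse_pair_dual[OF assms] unfolding twist_def by auto

text \<open>Dualizing toggles the flag \<open>b\<close>: an absent dual is introduced, a present one
  is cancelled by \<open>dual_dual\<close>.\<close>

lemma dual_twist:
  assumes "inverse_pair (m + n) P Q"
  shows "dual (if b then n else m) (if b then m else n) (map_mat (cj \<sigma>) (twist b m n P))
    = map_mat (cj \<sigma>) (twist (\<not> b) m n P)"
proof (cases b)
  case True
  have "dual n m (map_mat (cj \<sigma>) (dual m n P)) = dual n m (dual m n (map_mat (cj \<sigma>) P))"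
    using map_cj_dual[OF assms] by simp
  also have "\<dots> = map_mat (cj \<sigma>) P"
    by (rule dual_dual[OF inverse_pair_map_cj[OF assms]])
  finally show ?thesis using True by (simp add: twist_def)
qed (simp add: twist_def map_cj_dual[OF assms])

text \<open>Moves the conjugation outside, so that (R) only involves \<open>P\<close> and its dual
  under entrywise ring endomorphisms, as in \<open>roth_system\<close>.\<close>

lemma angle_op_gen_op:
  assumes "inverse_pair (m + n) P Q"
  shows "angle_op gen_op m n \<sigma> P = map_mat (cj \<sigma>) (twist (contra \<sigma>) m n P)"
proof (cases "contra \<sigma>")
  case True
  have "inverse_pair (m + n) (gen_op \<sigma> P) (adj (map_mat (cj \<sigma>) Q))"
    using True inverse_pair_adj[OF inverse_pair_map_cj[OF assms]] by (simp add: gen_op_def)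
  then have "angle_op gen_op m n \<sigma> P = J_mat m n * adj (map_mat (cj \<sigma>) Q) * J_inv m n"
    using True by (simp add: angle_op_def contra_def inv_mat_eqI inv_mat_eqI[OF J_inverse_pair])
  also have "\<dots> = dual m n (map_mat (cj \<sigma>) P)"
    by (rule dual_eq[OF inverse_pair_map_cj[OF assms], symmetric])
  finally show ?thesis using True by (simp add: twist_def map_cj_dual[OF assms])
qed (simp add: angle_op_def contra_def gen_op_def twist_def)

section \<open>Passing to the adjoint equations\<close>

text \<open>The result is the block triangular matrix of
  \<open>adj B * adj Y - adj X * adj A = - adj C\<close>, the negated adjoint of
  \<open>A X - Y B = C\<close>; conjugation by \<open>J\<close> restores upper triangular
  form.\<close>

lemma J_adj_four_block_J:
  assumes "A \<in> carrier_mat m' m" "B \<in> carrier_mat n' n" "C \<in> carrier_mat m' n"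
  shows "J_mat m n * adj (four_block_mat A C (0\<^sub>m n' m) B) * J_inv m' n'
    = four_block_mat (adj B) (- adj C) (0\<^sub>m m n') (adj A)"
proof -
  note c = adj_carrier[OF assms(1)] adj_carrier[OF assms(2)] adj_carrier[OF assms(3)]
  have "J_mat m n * adj (four_block_mat A C (0\<^sub>m n' m) B)
      = four_block_mat (adj C) (adj B) (- adj A) (0\<^sub>m m n')"
    unfolding J_mat_def adj_four_block_mat[OF assms(1,3) zero_carrier_mat assms(2)]
    using c assms by (simp add: mult_four_block_mat[of _ n m _ n _ m _ _ m' _ n'])
  then show ?thesis
    unfolding J_inv_def
    using c assms by (simp add: mult_four_block_mat[of _ n m' _ n' _ m _ _ n' _ m'])
qed

text \<open>From \<open>D U = W M\<close> follows \<open>W^-1 D = M U^-1\<close>. Taking adjoints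
  and conjugating by \<open>J\<close> gives the claim, with the roles of \<open>U\<close> and
  \<open>W\<close> exchanged.\<close>

lemma dual_intertwining:
  assumes U: "inverse_pair (m + n) U U'" and W: "inverse_pair (m' + n') W W'"
    and D: "D \<in> carrier_mat (m' + n') (m + n)" and M: "M \<in> carrier_mat (m' + n') (m + n)"
    and eq: "D * U = W * M"
  shows "(J_mat m n * adj D * J_inv m' n') * dual m' n' W = dual m n U * (J_mat m n * adj M * J_inv m' n')"
proof -
  let ?N = "m + n" and ?N' = "m' + n'"
  note Uc = inverse_pairD[OF U] and Wc = inverse_pairD[OF W]
  have a: "\<And>X Y Z p q r s. X \<in> carrier_mat p q \<Longrightarrow> Y \<in> carrier_mat q r \<Longrightarrow> Z \<in> carrier_mat r s \<Longrightarrow>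
      X * Y * Z = X * (Y * Z :: 'a mat)" by (rule assoc_mult_mat)
  have "W' * D = W' * (D * (U * U'))" using Uc D by simp
  also have "\<dots> = W' * (D * U * U')" using Uc D a[of D ?N' ?N U ?N U' ?N] by simp
  also have "\<dots> = W' * (W * (M * U'))" unfolding eq using Uc Wc M a[of W ?N' ?N' M ?N U' ?N] by simp
  also have "\<dots> = W' * W * (M * U')" using Uc Wc M a[of W' ?N' ?N' W ?N' "M * U'" ?N] by simp
  also have "\<dots> = M * U'" using Uc Wc M by simp
  finally have "adj (W' * D) = adj (M * U')" by simp
  then have key: "adj D * adj W' = adj U' * adj M"
    using adj_mult[of W' ?N' ?N' D ?N] adj_mult[of M ?N' ?N U' ?N] Uc Wc D M by simp
  note J = J_carrier[of m n, where 'a = 'a] and J' = J_carrier[of m' n', where 'a = 'a]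
  have "J_inv m n * J_mat m n = (1\<^sub>m ?N :: 'a mat)" "J_inv m' n' * J_mat m' n' = (1\<^sub>m ?N' :: 'a mat)"
    using J_inverse_pair[where 'a = 'a] by (simp_all add: inverse_pair_def)
  note JJ = this
  have c: "adj D \<in> carrier_mat ?N ?N'" "adj M \<in> carrier_mat ?N ?N'" "adj U' \<in> carrier_mat ?N ?N"
    "adj W' \<in> carrier_mat ?N' ?N'"
    using Uc Wc D M by (auto intro: adj_carrier)
  \<comment> \<open>Cancels the inner factor \<open>J^-1 J\<close> between two conjugated
    matrices.\<close>
  have mid: "(X * Y * Z) * (Z' * V * T) = X * (Y * V) * T"
    if "X \<in> carrier_mat p p" "Y \<in> carrier_mat p q" "Z \<in> carrier_mat q q" "Z' \<in> carrier_mat q q"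
      "V \<in> carrier_mat q r" "T \<in> carrier_mat r r" "Z * Z' = 1\<^sub>m q" for X Y Z Z' V T :: "'a mat" and p q r
  proof -
    have XY: "X * Y \<in> carrier_mat p q" and VT: "V * T \<in> carrier_mat q r" and YV: "Y * V \<in> carrier_mat p r"
      using that by auto
    have "(X * Y * Z) * (Z' * V * T) = X * Y * (Z * Z' * (V * T))"
      using that VT a[OF that(4,5,6)] a[OF XY that(3), of "Z' * (V * T)" r] a[OF that(3,4) VT] by simp
    also have "\<dots> = X * (Y * (V * T))" using that(7) left_mult_one_mat[OF VT] a[OF that(1,2) VT] by simp
    also have "\<dots> = X * (Y * V) * T"
      using a[OF that(2,5,6)] a[OF that(1) YV that(6)] by simp
    finally show ?thesis .
  qed
  show ?thesis
    unfolding dual_eq[OF U] dual_eq[OF W]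
      mid[OF J(1) c(1) J'(2) J'(1) c(4) J'(2) JJ(2)] mid[OF J(1) c(3) J(2) J(1) c(2) J'(2) JJ(1)] key ..
qed

section \<open>From a solution to (R)\<close>

lemma block_condition_gen_op:
  assumes indices: "\<forall>i<s. u i < t \<and> v i < t"
    and sizes: "compatible_sizes s m n u v \<epsilon> \<delta> A B C"
    and P: "\<And>j. j < t \<Longrightarrow> inverse_pair (m j + n j) (P j) (Q j)"
  shows "block_condition gen_op s m n u v \<epsilon> \<delta> A B C P \<longleftrightarrow>
    (\<forall>i<s. four_block_mat (A i) (0\<^sub>m (op_rows (\<delta> i) (m (v i)) (n (v i))) (op_cols (\<epsilon> i) (m (u i)) (n (u i))))
          (0\<^sub>m (op_cols (\<delta> i) (m (v i)) (n (v i))) (op_rows (\<epsilon> i) (m (u i)) (n (u i)))) (B i)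
        * map_mat (cj (\<epsilon> i)) (twist (contra (\<epsilon> i)) (m (u i)) (n (u i)) (P (u i)))
      = map_mat (cj (\<delta> i)) (twist (contra (\<delta> i)) (m (v i)) (n (v i)) (P (v i)))
        * four_block_mat (A i) (C i)
          (0\<^sub>m (op_cols (\<delta> i) (m (v i)) (n (v i))) (op_rows (\<epsilon> i) (m (u i)) (n (u i)))) (B i))"
  unfolding block_condition_def
proof (intro all_cong1 imp_cong refl)
  fix i assume i: "i < s"
  have *: "A i \<in> carrier_mat (op_rows (\<delta> i) (m (v i)) (n (v i))) (op_rows (\<epsilon> i) (m (u i)) (n (u i)))"
    "B i \<in> carrier_mat (op_cols (\<delta> i) (m (v i)) (n (v i))) (op_cols (\<epsilon> i) (m (u i)) (n (u i)))"
    using sizes i by (simp_all add: compatible_sizes_def Let_def)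
  have "angle_op gen_op (m (u i)) (n (u i)) (\<epsilon> i) (P (u i))
      = map_mat (cj (\<epsilon> i)) (twist (contra (\<epsilon> i)) (m (u i)) (n (u i)) (P (u i)))"
    "angle_op gen_op (m (v i)) (n (v i)) (\<delta> i) (P (v i))
      = map_mat (cj (\<delta> i)) (twist (contra (\<delta> i)) (m (v i)) (n (v i)) (P (v i)))"
    using angle_op_gen_op[OF P] indices i by auto
  then show "(four_block_mat (A i) (0\<^sub>m (dim_row (A i)) (dim_col (B i))) (0\<^sub>m (dim_row (B i)) (dim_col (A i))) (B i) *
          angle_op gen_op (m (u i)) (n (u i)) (\<epsilon> i) (P (u i)) =
          angle_op gen_op (m (v i)) (n (v i)) (\<delta> i) (P (v i)) *
          four_block_mat (A i) (C i) (0\<^sub>m (dim_row (B i)) (dim_col (A i))) (B i)) =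
    (four_block_mat (A i) (0\<^sub>m (op_rows (\<delta> i) (m (v i)) (n (v i))) (op_cols (\<epsilon> i) (m (u i)) (n (u i))))
          (0\<^sub>m (op_cols (\<delta> i) (m (v i)) (n (v i))) (op_rows (\<epsilon> i) (m (u i)) (n (u i)))) (B i)
        * map_mat (cj (\<epsilon> i)) (twist (contra (\<epsilon> i)) (m (u i)) (n (u i)) (P (u i)))
      = map_mat (cj (\<delta> i)) (twist (contra (\<delta> i)) (m (v i)) (n (v i)) (P (v i)))
        * four_block_mat (A i) (C i)
          (0\<^sub>m (op_cols (\<delta> i) (m (v i)) (n (v i))) (op_rows (\<epsilon> i) (m (u i)) (n (u i)))) (B i))"
    using carrier_matD[OF *(1)] carrier_matD[OF *(2)] by simp
qed

lemma gen_op_carrier: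
  "X \<in> carrier_mat k l \<Longrightarrow> gen_op \<sigma> X \<in> carrier_mat (op_rows \<sigma> k l) (op_cols \<sigma> k l)"
  by (auto simp: gen_op_def op_rows_flip op_cols_flip flip_size_def intro: adj_carrier)

text \<open>Inverting negates \<open>X\<close>, and conjugating the adjoint by \<open>J\<close>
  negates the off-diagonal block once more, so the dual again has the form
  \<open>[I, adj X; 0, I]\<close>.\<close>

lemma map_cj_twist_unipotent:
  assumes X: "X \<in> carrier_mat k l"
  shows "map_mat (cj \<sigma>) (twist (contra \<sigma>) k l (four_block_mat (1\<^sub>m k) X (0\<^sub>m l k) (1\<^sub>m l)))
    = four_block_mat (1\<^sub>m (op_rows \<sigma> k l)) (gen_op \<sigma> X)
        (0\<^sub>m (op_cols \<sigma> k l) (op_rows \<sigma> k l)) (1\<^sub>m (op_cols \<sigma> k l))"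
proof -
  have map: "map_mat (cj \<sigma>) (four_block_mat (1\<^sub>m a) Y (0\<^sub>m b a) (1\<^sub>m b))
      = four_block_mat (1\<^sub>m a) (map_mat (cj \<sigma>) Y) (0\<^sub>m b a) (1\<^sub>m b)"
    if "Y \<in> carrier_mat a b" for Y a b
    using that real_hom_0[OF real_hom_cj] real_hom_1[OF real_hom_cj] by (intro eq_matI) auto
  show ?thesis
  proof (cases "contra \<sigma>")
    case True
    have "dual k l (four_block_mat (1\<^sub>m k) X (0\<^sub>m l k) (1\<^sub>m l))
        = four_block_mat (1\<^sub>m l) (adj X) (0\<^sub>m k l) (1\<^sub>m k)"
      unfolding dual_eq[OF inverse_pair_unipotent[OF X]]
      by (subst J_adj_four_block_J) (use X in auto)
    then show ?thesis
      using True map[OF adj_carrier[OF X]]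
      by (simp add: twist_def gen_op_def op_rows_flip op_cols_flip flip_size_def map_cj_adj)
  next
    case False
    then show ?thesis
      using map[OF X] by (simp add: twist_def gen_op_def op_rows_flip op_cols_flip flip_size_def)
  qed
qed

text \<open>For \<open>P = [I, X; 0, I]\<close> both sides of (R) are block triangular with diagonal
  \<open>A\<close>, \<open>B\<close>; equality of the upper right blocks is the equation of
  (S).\<close>

lemma solution_imp_block_condition:
  assumes indices: "\<forall>i<s. u i < t \<and> v i < t"
    and sizes: "compatible_sizes s m n u v \<epsilon> \<delta> A B C"
    and sol: "has_solution gen_op s t m n u v \<epsilon> \<delta> A B C"
  shows "\<exists>P. (\<forall>j<t. P j \<in> carrier_mat (m j + n j) (m j + n j) \<and> invertible_mat (P j)) \<and>
    block_condition gen_op s m n u v \<epsilon> \<delta> A B C P"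
proof -
  obtain X where X: "\<And>j. j < t \<Longrightarrow> X j \<in> carrier_mat (m j) (n j)"
    and eq: "\<And>i. i < s \<Longrightarrow> A i * gen_op (\<epsilon> i) (X (u i)) - gen_op (\<delta> i) (X (v i)) * B i = C i"
    using sol unfolding has_solution_def by blast
  define P where "P j = four_block_mat (1\<^sub>m (m j)) (X j) (0\<^sub>m (n j) (m j)) (1\<^sub>m (n j))" for j
  have P: "inverse_pair (m j + n j) (P j) (four_block_mat (1\<^sub>m (m j)) (- X j) (0\<^sub>m (n j) (m j)) (1\<^sub>m (n j)))"
    if "j < t" for j
    unfolding P_def by (rule inverse_pair_unipotent[OF X[OF that]])
  have "block_condition gen_op s m n u v \<epsilon> \<delta> A B C P"
  proof (subst block_condition_gen_op[OF indices sizes P], assumption, intro allI impI)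
    fix i assume i: "i < s"
    define rX cX rY cY where sz: "rX = op_rows (\<epsilon> i) (m (u i)) (n (u i))" "cX = op_cols (\<epsilon> i) (m (u i)) (n (u i))"
      "rY = op_rows (\<delta> i) (m (v i)) (n (v i))" "cY = op_cols (\<delta> i) (m (v i)) (n (v i))"
    have c: "A i \<in> carrier_mat rY rX" "B i \<in> carrier_mat cY cX" "C i \<in> carrier_mat rY cX"
      using sizes i by (simp_all add: compatible_sizes_def Let_def sz)
    let ?X = "gen_op (\<epsilon> i) (X (u i))" and ?Y = "gen_op (\<delta> i) (X (v i))"
    have uv: "u i < t" "v i < t" using indices i by auto
    have XY: "?X \<in> carrier_mat rX cX" "?Y \<in> carrier_mat rY cY"
      unfolding sz by (intro gen_op_carrier X uv)+
    have prods: "A i * ?X \<in> carrier_mat rY cX" "?Y * B i \<in> carrier_mat rY cX"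
      using c XY by auto
    have sum: "A i * ?X = C i + ?Y * B i"
      unfolding eq[OF i, symmetric] using prods c XY by (intro eq_matI) auto
    have "four_block_mat (A i) (0\<^sub>m rY cX) (0\<^sub>m cY rX) (B i) * four_block_mat (1\<^sub>m rX) ?X (0\<^sub>m cX rX) (1\<^sub>m cX)
        = four_block_mat (A i) (A i * ?X) (0\<^sub>m cY rX) (B i)"
      using c XY prods by (simp add: mult_four_block_mat[of _ rY rX _ cX _ cY _ _ rX _ cX])
    also have "\<dots> = four_block_mat (1\<^sub>m rY) ?Y (0\<^sub>m cY rY) (1\<^sub>m cY) * four_block_mat (A i) (C i) (0\<^sub>m cY rX) (B i)"
      unfolding sum using c XY prods by (simp add: mult_four_block_mat[of _ rY rY _ cY _ cY _ _ rX _ cX])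
    finally show "four_block_mat (A i) (0\<^sub>m (op_rows (\<delta> i) (m (v i)) (n (v i))) (op_cols (\<epsilon> i) (m (u i)) (n (u i))))
          (0\<^sub>m (op_cols (\<delta> i) (m (v i)) (n (v i))) (op_rows (\<epsilon> i) (m (u i)) (n (u i)))) (B i)
        * map_mat (cj (\<epsilon> i)) (twist (contra (\<epsilon> i)) (m (u i)) (n (u i)) (P (u i)))
      = map_mat (cj (\<delta> i)) (twist (contra (\<delta> i)) (m (v i)) (n (v i)) (P (v i)))
        * four_block_mat (A i) (C i)
          (0\<^sub>m (op_cols (\<delta> i) (m (v i)) (n (v i))) (op_rows (\<epsilon> i) (m (u i)) (n (u i)))) (B i)"
      unfolding P_def map_cj_twist_unipotent[OF X[OF uv(1)]] map_cj_twist_unipotent[OF X[OF uv(2)]] sz .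
  qed
  moreover have "\<forall>j<t. P j \<in> carrier_mat (m j + n j) (m j + n j) \<and> invertible_mat (P j)"
    using P invertible_mat_inverse_pair inverse_pairD(1) by blast
  ultimately show ?thesis by blast
qed

section \<open>From (R) to a solution\<close>

text \<open>Applying \<open>dual_intertwining\<close> to one equation of (R) yields the equation for
  the adjoint, with both flags toggled by \<open>dual_twist\<close>.\<close>

lemma dual_block_condition:
  assumes P: "inverse_pair (k + l) P Q" and P': "inverse_pair (k' + l') P' Q'"
    and A: "A \<in> carrier_mat (flip_size b' k' l') (flip_size b k l)"
    and B: "B \<in> carrier_mat (flip_size b' l' k') (flip_size b l k)"
    and C: "C \<in> carrier_mat (flip_size b' k' l') (flip_size b l k)"
    and eq: "four_block_mat A (0\<^sub>m (flip_size b' k' l') (flip_size b l k)) (0\<^sub>m (flip_size b' l' k') (flip_size b k l)) B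
        * map_mat (cj \<sigma>) (twist b k l P)
      = map_mat (cj \<tau>) (twist b' k' l' P')
        * four_block_mat A C (0\<^sub>m (flip_size b' l' k') (flip_size b k l)) B"
  shows "four_block_mat (adj B) (0\<^sub>m (flip_size b l k) (flip_size b' k' l')) (0\<^sub>m (flip_size b k l) (flip_size b' l' k')) (adj A)
        * map_mat (cj \<tau>) (twist (\<not> b') k' l' P')
      = map_mat (cj \<sigma>) (twist (\<not> b) k l P)
        * four_block_mat (adj B) (- adj C) (0\<^sub>m (flip_size b k l) (flip_size b' l' k')) (adj A)"
proof -
  define rX cX rY cY where sz: "rX = flip_size b k l" "cX = flip_size b l k"
    "rY = flip_size b' k' l'" "cY = flip_size b' l' k'"
  have s: "rX + cX = k + l" "rY + cY = k' + l'" by (simp_all add: sz flip_size_add)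
  obtain U where U: "inverse_pair (rX + cX) (map_mat (cj \<sigma>) (twist b k l P)) U"
    unfolding s using inverse_pair_twist[OF P] inverse_pair_map_cj by blast
  obtain W where W: "inverse_pair (rY + cY) (map_mat (cj \<tau>) (twist b' k' l' P')) W"
    unfolding s using inverse_pair_twist[OF P'] inverse_pair_map_cj by blast
  have c: "A \<in> carrier_mat rY rX" "B \<in> carrier_mat cY cX" "C \<in> carrier_mat rY cX"
    using A B C by (simp_all add: sz)
  have D: "four_block_mat A (0\<^sub>m rY cX) (0\<^sub>m cY rX) B \<in> carrier_mat (rY + cY) (rX + cX)"
    and M: "four_block_mat A C (0\<^sub>m cY rX) B \<in> carrier_mat (rY + cY) (rX + cX)"
    using c by auto
  have "dual rX cX (map_mat (cj \<sigma>) (twist b k l P)) = map_mat (cj \<sigma>) (twist (\<not> b) k l P)"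
    "dual rY cY (map_mat (cj \<tau>) (twist b' k' l' P')) = map_mat (cj \<tau>) (twist (\<not> b') k' l' P')"
    unfolding sz flip_size_def by (rule dual_twist[OF P] dual_twist[OF P'])+
  with dual_intertwining[OF U W D M eq[folded sz], unfolded J_adj_four_block_J[OF c]
      J_adj_four_block_J[OF c(1,2) zero_carrier_mat]]
  show ?thesis by (simp add: sz)
qed

lemma adj_scaleR: "adj (map_mat ((*\<^sub>R) r) A) = map_mat ((*\<^sub>R) r) (adj A)"
  by (rule eq_matI) (auto simp: linear_scale[OF d(1)])

lemma adj_add: "A \<in> carrier_mat k l \<Longrightarrow> B \<in> carrier_mat k l \<Longrightarrow> adj (A + B) = adj A + adj B"
  by (rule eq_matI) (auto simp: linear_add[OF d(1)])

lemma adj_minus: "A \<in> carrier_mat k l \<Longrightarrow> B \<in> carrier_mat k l \<Longrightarrow> adj (A - B) = adj A - adj B"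
  by (rule eq_matI) (auto simp: linear_diff[OF d(1)])

text \<open>Below, \<open>Y (j, False)\<close> stands for \<open>X\<^sub>j\<close> and \<open>Y (j, True)\<close> for its adjoint.\<close>

lemma block_condition_imp_solution:
  assumes indices: "\<forall>i<s. u i < t \<and> v i < t"
    and sizes: "compatible_sizes s m n u v \<epsilon> \<delta> A B C"
    and P: "\<And>j. j < t \<Longrightarrow> P j \<in> carrier_mat (m j + n j) (m j + n j)"
      "\<And>j. j < t \<Longrightarrow> invertible_mat (P j)"
    and block: "block_condition gen_op s m n u v \<epsilon> \<delta> A B C P"
  shows "has_solution gen_op s t m n u v \<epsilon> \<delta> A B C"
proof -
  have "\<forall>j. \<exists>Q. j < t \<longrightarrow> inverse_pair (m j + n j) (P j) Q"
    using P invertible_mat_inverse_pair by blast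
  then obtain Q where Q: "\<And>j. j < t \<Longrightarrow> inverse_pair (m j + n j) (P j) (Q j)" by metis
  define p where "p k = flip_size (snd k) (m (fst k)) (n (fst k))" for k :: "nat \<times> bool"
  define q where "q k = flip_size (snd k) (n (fst k)) (m (fst k))" for k :: "nat \<times> bool"
  \<comment> \<open>The transposition in an exponent is absorbed into the index of the unknown; only
    the conjugation \<open>cj\<close> remains to be applied.\<close>
  define x where "x i = (u i, contra (\<epsilon> i))" for i
  define y where "y i = (v i, contra (\<delta> i))" for i
  define co where "co k = (fst k, \<not> snd k)" for k :: "nat \<times> bool"
  have pq_co: "p (co k) = q k" "q (co k) = p k" for k
    by (auto simp: p_def q_def co_def flip_size_def)
  have AB: "A i \<in> carrier_mat (p (y i)) (p (x i))" "B i \<in> carrier_mat (q (y i)) (q (x i))"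
    "C i \<in> carrier_mat (p (y i)) (q (x i))" if "i < s" for i
    using sizes that
    by (simp_all add: compatible_sizes_def Let_def p_def q_def x_def y_def op_rows_flip op_cols_flip)
  have xy: "x i \<in> {..<t} \<times> UNIV" "y i \<in> {..<t} \<times> UNIV" "co (x i) \<in> {..<t} \<times> UNIV" "co (y i) \<in> {..<t} \<times> UNIV"
    if "i < s" for i
    using indices that by (auto simp: x_def y_def co_def)
  \<comment> \<open>The unknown \<open>X_j\<close> gets the matrix \<open>P_j\<close>, its adjoint
    gets the dual of \<open>P_j\<close>.\<close>
  define T where "T k = twist (snd k) (m (fst k)) (n (fst k)) (P (fst k))" for k
  have "\<exists>T'. inverse_pair (p k + q k) (T k) T'" if "k \<in> {..<t} \<times> UNIV" for k
    using inverse_pair_twist[OF Q] that by (auto simp: p_def q_def T_def flip_size_add)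
  then obtain T' where T': "\<And>k. k \<in> {..<t} \<times> UNIV \<Longrightarrow> inverse_pair (p k + q k) (T k) (T' k)" by metis
  have direct: "four_block_mat (A i) (0\<^sub>m (p (y i)) (q (x i))) (0\<^sub>m (q (y i)) (p (x i))) (B i) * map_mat (cj (\<epsilon> i)) (T (x i))
      = map_mat (cj (\<delta> i)) (T (y i)) * four_block_mat (A i) (C i) (0\<^sub>m (q (y i)) (p (x i))) (B i)"
    if "i < s" for i
    using block_condition_gen_op[OF indices sizes Q] block that
    by (simp add: p_def q_def x_def y_def T_def op_rows_flip op_cols_flip)
  have adjoint: "four_block_mat (adj (B i)) (0\<^sub>m (q (x i)) (p (y i))) (0\<^sub>m (p (x i)) (q (y i))) (adj (A i)) * map_mat (cj (\<delta> i)) (T (co (y i)))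
      = map_mat (cj (\<epsilon> i)) (T (co (x i))) * four_block_mat (adj (B i)) (- adj (C i)) (0\<^sub>m (p (x i)) (q (y i))) (adj (A i))"
    if i: "i < s" for i
  proof -
    have "u i < t" "v i < t" using indices i by auto
    from dual_block_condition[OF Q[OF this(1)] Q[OF this(2)]] AB[OF i] direct[OF i]
    show ?thesis by (simp add: p_def q_def x_def y_def T_def co_def)
  qed
  obtain S :: "'a set" where S: "finite S" "span S = UNIV" using finite_dim by blast
  \<comment> \<open>The flag chooses between an equation and its adjoint. In the adjoint the two
    unknowns and the two exponents change places.\<close>
  define I where "I = {..<s} \<times> (UNIV :: bool set)"
  have I: "fst i < s" if "i \<in> I" for i using that by (auto simp: I_def)
  note AB' = adj_carrier[OF AB(1)] adj_carrier[OF AB(2)] adj_carrier[OF AB(3)]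
  have "\<exists>Y. (\<forall>k\<in>{..<t} \<times> UNIV. Y k \<in> carrier_mat (p k) (q k)) \<and>
    (\<forall>i\<in>I. (if snd i then adj (B (fst i)) else A (fst i))
        * map_mat (if snd i then cj (\<delta> (fst i)) else cj (\<epsilon> (fst i))) (Y (if snd i then co (y (fst i)) else x (fst i)))
      - map_mat (if snd i then cj (\<epsilon> (fst i)) else cj (\<delta> (fst i))) (Y (if snd i then co (x (fst i)) else y (fst i)))
        * (if snd i then adj (A (fst i)) else B (fst i))
      = (if snd i then - adj (C (fst i)) else C (fst i)))"
  proof (rule roth_system[OF S, where P = T and Q = T'])
    fix i assume "i \<in> I"
    then have i: "fst i < s" by (rule I)
    show "four_block_mat (if snd i then adj (B (fst i)) else A (fst i))
          (0\<^sub>m (p (if snd i then co (x (fst i)) else y (fst i))) (q (if snd i then co (y (fst i)) else x (fst i))))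
          (0\<^sub>m (q (if snd i then co (x (fst i)) else y (fst i))) (p (if snd i then co (y (fst i)) else x (fst i))))
          (if snd i then adj (A (fst i)) else B (fst i)) *
         map_mat (if snd i then cj (\<delta> (fst i)) else cj (\<epsilon> (fst i))) (T (if snd i then co (y (fst i)) else x (fst i))) =
         map_mat (if snd i then cj (\<epsilon> (fst i)) else cj (\<delta> (fst i))) (T (if snd i then co (x (fst i)) else y (fst i))) *
         four_block_mat (if snd i then adj (B (fst i)) else A (fst i)) (if snd i then - adj (C (fst i)) else C (fst i))
          (0\<^sub>m (q (if snd i then co (x (fst i)) else y (fst i))) (p (if snd i then co (y (fst i)) else x (fst i))))
          (if snd i then adj (A (fst i)) else B (fst i))"
      using direct[OF i] adjoint[OF i] by (simp add: pq_co)
  qed (use I xy AB AB' inverse_pairD[OF T'] real_hom_cj pq_co in auto)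
  then obtain Y where Y: "\<And>k. k \<in> {..<t} \<times> UNIV \<Longrightarrow> Y k \<in> carrier_mat (p k) (q k)"
    and YI: "\<And>i. i \<in> I \<Longrightarrow> (if snd i then adj (B (fst i)) else A (fst i))
        * map_mat (if snd i then cj (\<delta> (fst i)) else cj (\<epsilon> (fst i))) (Y (if snd i then co (y (fst i)) else x (fst i)))
      - map_mat (if snd i then cj (\<epsilon> (fst i)) else cj (\<delta> (fst i))) (Y (if snd i then co (x (fst i)) else y (fst i)))
        * (if snd i then adj (A (fst i)) else B (fst i))
      = (if snd i then - adj (C (fst i)) else C (fst i))"
    by (elim exE conjE) blast
  have Y1: "A i * map_mat (cj (\<epsilon> i)) (Y (x i)) - map_mat (cj (\<delta> i)) (Y (y i)) * B i = C i" if "i < s" for i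
    using YI[of "(i, False)"] that by (simp add: I_def)
  have Y2: "adj (B i) * map_mat (cj (\<delta> i)) (Y (co (y i)))
      - map_mat (cj (\<epsilon> i)) (Y (co (x i))) * adj (A i) = - adj (C i)" if "i < s" for i
    using YI[of "(i, True)"] that by (simp add: I_def)
  \<comment> \<open>The two unknowns of a pair need not be adjoint to each other; this average makes
    \<open>H (co k)\<close> the adjoint of \<open>H k\<close>.\<close>
  define H where "H k = map_mat ((*\<^sub>R) (1/2)) (Y k + adj (Y (co k)))" for k
  have Yco: "adj (Y (co k)) \<in> carrier_mat (p k) (q k)" "Y (co k) \<in> carrier_mat (q k) (p k)"
    if "k \<in> {..<t} \<times> UNIV" for k
  proof -
    have "co k \<in> {..<t} \<times> UNIV" using that by (auto simp: co_def)
    from Y[OF this] show "Y (co k) \<in> carrier_mat (q k) (p k)" by (simp add: pq_co)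
    then show "adj (Y (co k)) \<in> carrier_mat (p k) (q k)" by (rule adj_carrier)
  qed
  have Hc: "H k \<in> carrier_mat (p k) (q k)" if "k \<in> {..<t} \<times> UNIV" for k
    using Y[OF that] Yco[OF that] by (simp add: H_def)
  have adjH: "adj (H k) = H (co k)" if "k \<in> {..<t} \<times> UNIV" for k
  proof -
    have "adj (Y k + adj (Y (co k))) = Y (co k) + adj (Y k)"
      using Y[OF that] Yco[OF that] by (subst adj_add) (auto intro!: comm_add_mat adj_carrier)
    then show ?thesis by (simp add: H_def adj_scaleR co_def)
  qed
  \<comment> \<open>Adjointness of the pair turns the independent unknown \<open>H (j, True)\<close>
    back into the adjoint of \<open>H (j, False)\<close>.\<close>
  have genH: "gen_op \<sigma> (H (j, False)) = map_mat (cj \<sigma>) (H (j, contra \<sigma>))" if "j < t" for \<sigma> j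
    using adjH[of "(j, False)"] that by (simp add: gen_op_def co_def flip: map_cj_adj)
  have "A i * gen_op (\<epsilon> i) (H (u i, False)) - gen_op (\<delta> i) (H (v i, False)) * B i = C i" if i: "i < s" for i
  proof -
    note c = AB[OF i] and k = xy[OF i]
    define E where "E = map_mat (cj (\<epsilon> i))"
    define D where "D = map_mat (cj (\<delta> i))"
    have EDc: "E Z \<in> carrier_mat a b" "D Z \<in> carrier_mat a b" if "Z \<in> carrier_mat a b" for Z a b
      using that by (simp_all add: E_def D_def)
    have EH: "E (H (x i)) = map_mat ((*\<^sub>R) (1/2)) (E (Y (x i)) + E (adj (Y (co (x i)))))"
      unfolding H_def E_def real_hom_scaleR_mat[OF real_hom_cj] real_hom_add_mat[OF real_hom_cj Y[OF k(1)] Yco(1)[OF k(1)]] ..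
    have DH: "D (H (y i)) = map_mat ((*\<^sub>R) (1/2)) (D (Y (y i)) + D (adj (Y (co (y i)))))"
      unfolding H_def D_def real_hom_scaleR_mat[OF real_hom_cj] real_hom_add_mat[OF real_hom_cj Y[OF k(2)] Yco(1)[OF k(2)]] ..
    have x1: "E (Y (x i)) \<in> carrier_mat (p (x i)) (q (x i))" "E (adj (Y (co (x i)))) \<in> carrier_mat (p (x i)) (q (x i))"
      and y1: "D (Y (y i)) \<in> carrier_mat (p (y i)) (q (y i))" "D (adj (Y (co (y i)))) \<in> carrier_mat (p (y i)) (q (y i))"
      using EDc Y[OF k(1)] Y[OF k(2)] Yco(1)[OF k(1)] Yco(1)[OF k(2)] by blast+
    have AE: "A i * E (H (x i)) = map_mat ((*\<^sub>R) (1/2)) (A i * E (Y (x i)) + A i * E (adj (Y (co (x i)))))"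
      unfolding EH mult_add_distrib_mat[OF c(1) x1, symmetric]
      by (rule map_scaleR_mult_mat(2)[OF c(1) add_carrier_mat[OF x1(2)], symmetric])
    have DB: "D (H (y i)) * B i = map_mat ((*\<^sub>R) (1/2)) (D (Y (y i)) * B i + D (adj (Y (co (y i)))) * B i)"
      unfolding DH add_mult_distrib_mat[OF y1 c(2), symmetric]
      by (rule map_scaleR_mult_mat(1)[OF add_carrier_mat[OF y1(2)] c(2), symmetric])
    have e1: "A i * E (Y (x i)) - D (Y (y i)) * B i = C i"
      using Y1[OF i] by (simp add: E_def D_def)
    \<comment> \<open>Taking adjoints of the added equation shows that the adjoints of the partner
      unknowns also solve the original equation.\<close>
    have "adj (adj (B i) * D (Y (co (y i))) - E (Y (co (x i))) * adj (A i)) = - C i"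
      using Y2[OF i] by (simp add: E_def D_def)
    moreover have "adj (adj (B i) * D (Y (co (y i))) - E (Y (co (x i))) * adj (A i))
        = adj (adj (B i) * D (Y (co (y i)))) - adj (E (Y (co (x i))) * adj (A i))"
      by (rule adj_minus[OF mult_carrier_mat mult_carrier_mat])
        (use adj_carrier[OF c(1)] adj_carrier[OF c(2)] EDc Yco(2)[OF k(1)] Yco(2)[OF k(2)] in blast)+
    moreover have "adj (adj (B i) * D (Y (co (y i)))) = D (adj (Y (co (y i)))) * B i"
      using adj_mult[OF adj_carrier[OF c(2)] EDc(2)[OF Yco(2)[OF k(2)]]] by (simp add: D_def map_cj_adj)
    moreover have "adj (E (Y (co (x i))) * adj (A i)) = A i * E (adj (Y (co (x i))))"
      using adj_mult[OF EDc(1)[OF Yco(2)[OF k(1)]] adj_carrier[OF c(1)]] by (simp add: E_def map_cj_adj)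
    ultimately have e2: "D (adj (Y (co (y i)))) * B i - A i * E (adj (Y (co (x i)))) = - C i" by simp
    \<comment> \<open>The equation is affine, so the mean of two solutions is a solution; the second
      one is given with reversed sign.\<close>
    have avg: "map_mat ((*\<^sub>R) (1/2)) (a + a') - map_mat ((*\<^sub>R) (1/2)) (b + b') = r"
      if "a - b = r" "b' - a' = - r" "a \<in> carrier_mat k l" "a' \<in> carrier_mat k l"
        "b \<in> carrier_mat k l" "b' \<in> carrier_mat k l" for a a' b b' r :: "'a mat" and k l
    proof (rule eq_matI)
      fix i j assume "i < dim_row r" "j < dim_col r"
      then have ij: "i < k" "j < l" using that(1,3,5) by auto
      have "r $$ (i, j) = a $$ (i, j) - b $$ (i, j)" using that ij by auto
      moreover have "(b' - a') $$ (i, j) = - (r $$ (i, j))"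
        unfolding that(2) using \<open>i < dim_row r\<close> \<open>j < dim_col r\<close> by simp
      moreover have "(b' - a') $$ (i, j) = b' $$ (i, j) - a' $$ (i, j)"
        using that(4,6) ij by simp
      ultimately have "a $$ (i, j) + a' $$ (i, j) - (b $$ (i, j) + b' $$ (i, j)) = 2 *\<^sub>R r $$ (i, j)"
        by (simp add: scaleR_2 algebra_simps)
      then have "(1/2) *\<^sub>R (a $$ (i, j) + a' $$ (i, j) - (b $$ (i, j) + b' $$ (i, j))) = r $$ (i, j)"
        by simp
      then show "(map_mat ((*\<^sub>R) (1/2)) (a + a') - map_mat ((*\<^sub>R) (1/2)) (b + b')) $$ (i, j) = r $$ (i, j)"
        using that ij by (simp add: scaleR_diff_right)
    qed (use that in auto)
    have "A i * E (H (x i)) - D (H (y i)) * B i = C i"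
      unfolding AE DB
      by (rule avg[OF e1 e2 mult_carrier_mat[OF c(1) x1(1)] mult_carrier_mat[OF c(1) x1(2)]
            mult_carrier_mat[OF y1(1) c(2)] mult_carrier_mat[OF y1(2) c(2)]])
    then show ?thesis
      using genH indices i by (simp add: E_def D_def x_def y_def)
  qed
  moreover have "H (j, False) \<in> carrier_mat (m j) (n j)" if "j < t" for j
    using Hc[of "(j, False)"] that by (simp add: p_def q_def flip_size_def)
  ultimately show ?thesis
    unfolding has_solution_def by (intro exI[of _ "\<lambda>j. H (j, False)"]) auto
qed

text \<open>Agreement of \<open>pw\<close> with \<open>gen_op\<close> is asked only at exponents
  that occur, because the concrete operations are unspecified at the others.\<close>

lemma solvability_criterion:
  assumes indices: "\<forall>i<s. u i < t \<and> v i < t"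
    and sizes: "compatible_sizes s m n u v \<epsilon> \<delta> A B C"
    and pw: "\<And>i. i < s \<Longrightarrow> pw (\<epsilon> i) = gen_op (\<epsilon> i)" "\<And>i. i < s \<Longrightarrow> pw (\<delta> i) = gen_op (\<delta> i)"
  shows "has_solution pw s t m n u v \<epsilon> \<delta> A B C \<longleftrightarrow>
    (\<exists>P. (\<forall>j<t. P j \<in> carrier_mat (m j + n j) (m j + n j) \<and> invertible_mat (P j)) \<and>
      block_condition pw s m n u v \<epsilon> \<delta> A B C P)"
proof -
  have "has_solution pw s t m n u v \<epsilon> \<delta> A B C = has_solution gen_op s t m n u v \<epsilon> \<delta> A B C"
    unfolding has_solution_def using pw by (simp cong: imp_cong)
  moreover have "block_condition pw s m n u v \<epsilon> \<delta> A B C = block_condition gen_op s m n u v \<epsilon> \<delta> A B C"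
    unfolding block_condition_def angle_op_def using pw by (simp cong: imp_cong)
  ultimately show ?thesis
    using solution_imp_block_condition[OF indices sizes] block_condition_imp_solution[OF indices sizes]
    by auto
qed

end

section \<open>The real numbers, the complex numbers and the quaternions\<close>

instantiation quat :: real_algebra_1
begin

definition scaleR_quat :: "real \<Rightarrow> quat \<Rightarrow> quat" where
  "r *\<^sub>R x = Quat (r * q_re x) (r * q_i x) (r * q_j x) (r * q_k x)"

instance
  by standard
    (simp_all add: scaleR_quat_def plus_quat_def times_quat_def one_quat_def algebra_simps)

end

lemma span_one_real: "span {1 :: real} = UNIV"
proof -
  have "x *\<^sub>R 1 \<in> span {1 :: real}" for x
    by (intro span_scale span_base) simp
  then show ?thesis by auto
qed

lemma span_complex_units: "span {1, \<i>} = UNIV"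
proof -
  have "Re z *\<^sub>R 1 + Im z *\<^sub>R \<i> \<in> span {1, \<i>}" for z
    by (intro span_add span_scale span_base) simp_all
  moreover have "Re z *\<^sub>R 1 + Im z *\<^sub>R \<i> = z" for z by (simp add: complex_eq_iff)
  ultimately show ?thesis by (metis UNIV_eq_I)
qed

lemma span_quat_units: "span {Quat 1 0 0 0, Quat 0 1 0 0, Quat 0 0 1 0, Quat 0 0 0 1} = UNIV" (is "span ?S = _")
proof -
  have "q_re x *\<^sub>R Quat 1 0 0 0 + q_i x *\<^sub>R Quat 0 1 0 0 + q_j x *\<^sub>R Quat 0 0 1 0
      + q_k x *\<^sub>R Quat 0 0 0 1 \<in> span ?S" for x
    by (intro span_add span_scale span_base) simp_all
  moreover have "q_re x *\<^sub>R Quat 1 0 0 0 + q_i x *\<^sub>R Quat 0 1 0 0 + q_j x *\<^sub>R Quat 0 0 1 0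
      + q_k x *\<^sub>R Quat 0 0 0 1 = x" for x
    by (simp add: scaleR_quat_def plus_quat_def)
  ultimately show ?thesis by (metis UNIV_eq_I)
qed

interpretation R: involutive_algebra "id :: real \<Rightarrow> real" id
proof
  show "\<exists>S :: real set. finite S \<and> span S = UNIV"
    using span_one_real by (intro exI[of _ "{1}"]) simp
qed (auto simp: real_hom_def intro: linearI)

text \<open>By commutativity the identity reverses products, so it can serve as \<open>d\<close>;
  the same holds over the reals.\<close>

interpretation C: involutive_algebra cnj id
proof
  show "\<exists>S :: complex set. finite S \<and> span S = UNIV"
    using span_complex_units by (intro exI[of _ "{1, \<i>}"]) simp
qed (auto simp: real_hom_def intro: linearI)

text \<open>\<open>quat_compl\<close> is the inner automorphism \<open>h |-> i h i^-1\<close>.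
  \<open>quat_circ\<close> is its composite with quaternion conjugation and therefore reverses
  products.\<close>

interpretation H: involutive_algebra quat_compl quat_circ
proof
  show "\<exists>S :: quat set. finite S \<and> span S = UNIV"
    using span_quat_units by (metis finite.emptyI finite.insertI)
qed (auto simp: real_hom_def quat_compl_def quat_circ_def scaleR_quat_def plus_quat_def
    times_quat_def one_quat_def intro!: linearI)

lemma map_mat_id_eq [simp]: "map_mat id A = A"
  by (rule eq_matI) auto

lemma real_op_eq: "\<sigma> \<in> {Ident, Transp} \<Longrightarrow> real_op \<sigma> = R.gen_op \<sigma>"
  by (auto simp: fun_eq_iff R.gen_op_def R.adj_def R.cj_def contra_def)

lemma complex_op_eq: "\<sigma> \<in> {Ident, Compl, Transp, Star} \<Longrightarrow> complex_op \<sigma> = C.gen_op \<sigma>"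
  by (auto simp: fun_eq_iff C.gen_op_def C.adj_def C.cj_def contra_def)

lemma quat_op_eq: "\<sigma> \<in> {Ident, Compl, Dagger, Star} \<Longrightarrow> quat_op \<sigma> = H.gen_op \<sigma>"
  by (auto simp: fun_eq_iff H.gen_op_def H.adj_def H.cj_def contra_def quat_cnj_eq)

theorem corollary1:
  fixes s t :: nat
    and m n :: "nat \<Rightarrow> nat"
    and u v :: "nat \<Rightarrow> nat"
    and \<epsilon> \<delta> :: "nat \<Rightarrow> exponent"
    and A\<^sub>R B\<^sub>R C\<^sub>R :: "nat \<Rightarrow> real mat"
    and A\<^sub>C B\<^sub>C C\<^sub>C :: "nat \<Rightarrow> complex mat"
    and A\<^sub>H B\<^sub>H C\<^sub>H :: "nat \<Rightarrow> quat mat"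
  assumes indices: "\<forall>i<s. u i < t \<and> v i < t"
  shows
    "((\<forall>i<s. \<epsilon> i \<in> {Ident, Transp} \<and> \<delta> i \<in> {Ident, Transp}) \<and>
      compatible_sizes s m n u v \<epsilon> \<delta> A\<^sub>R B\<^sub>R C\<^sub>R \<longrightarrow>
        (has_solution real_op s t m n u v \<epsilon> \<delta> A\<^sub>R B\<^sub>R C\<^sub>R \<longleftrightarrow>
         (\<exists>P. (\<forall>j<t. P j \<in> carrier_mat (m j + n j) (m j + n j) \<and> invertible_mat (P j)) \<and>
              block_condition real_op s m n u v \<epsilon> \<delta> A\<^sub>R B\<^sub>R C\<^sub>R P)))
     \<and>
     ((\<forall>i<s. \<epsilon> i \<in> {Ident, Compl, Transp, Star} \<and> \<delta> i \<in> {Ident, Compl, Transp, Star}) \<and>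
      compatible_sizes s m n u v \<epsilon> \<delta> A\<^sub>C B\<^sub>C C\<^sub>C \<longrightarrow>
        (has_solution complex_op s t m n u v \<epsilon> \<delta> A\<^sub>C B\<^sub>C C\<^sub>C \<longleftrightarrow>
         (\<exists>P. (\<forall>j<t. P j \<in> carrier_mat (m j + n j) (m j + n j) \<and> invertible_mat (P j)) \<and>
              block_condition complex_op s m n u v \<epsilon> \<delta> A\<^sub>C B\<^sub>C C\<^sub>C P)))
     \<and>
     ((\<forall>i<s. \<epsilon> i \<in> {Ident, Compl, Dagger, Star} \<and> \<delta> i \<in> {Ident, Compl, Dagger, Star}) \<and>
      compatible_sizes s m n u v \<epsilon> \<delta> A\<^sub>H B\<^sub>H C\<^sub>H \<longrightarrow>
        (has_solution quat_op s t m n u v \<epsilon> \<delta> A\<^sub>H B\<^sub>H C\<^sub>H \<longleftrightarrow>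
         (\<exists>P. (\<forall>j<t. P j \<in> carrier_mat (m j + n j) (m j + n j) \<and> invertible_mat (P j)) \<and>
              block_condition quat_op s m n u v \<epsilon> \<delta> A\<^sub>H B\<^sub>H C\<^sub>H P)))"
  by (intro conjI impI R.solvability_criterion[OF indices] C.solvability_criterion[OF indices]
      H.solvability_criterion[OF indices])
    (blast intro: real_op_eq complex_op_eq quat_op_eq)+

end
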